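(* Let $$A=\begin{pmatrix}-1&1&0\\-1&0&1\\1&0&0\end{pmatrix}$$ and let $f$ be the associated monomial map from $\mathbb{CP}^3$ to itself, i.e. the projectivization of the affine map $(x,y,z)\mapsto(y/x,\,z/x,\,x)$. Then the sequence of degrees $$(\deg(f^N))_{N=0}^\infty=1,2,3,4,6,9,12,17,25,33,45,65,85,112,159,215,262,365,524,627,833,\dots$$ does not satisfy any linear recurrence with constant coefficients.
   Context: Projectivization. The projectivization of an affine rational map $(x_1,\dots,x_n)\mapsto(y_1,\dots,y_n)$ is the map $(x_1:\dots:x_{n+1})\mapsto(y_1:\dots:y_n:1)$, with the $y_i$ evaluated at $(x_1/x_{n+1},\dots,x_n/x_{n+1})$, rewritten by clearing denominators and removing common factors as $(p_1:\dots:p_{n+1})$ with $p_1,\dots,p_{n+1}$ homogeneous polynomials of the same degree with no joint common factor. This common degree is the degree of the map. Here $f^N$ denotes the $N$-fold composition of $f$, again written with common factors removed (rational maps agreeing on a Zariski-dense set are identified); it is the projectivization of the affine monomial map given by $A^N$, where an integer matrix $(a_{ij})$ gives the affine monomial map $y_i=\prod_j x_j^{a_{ij}}$. $f^0$ is the identity map. A sequence $(d_N)_{N\ge0}$ satisfies a linear recurrence with constant coefficients if there exist $k\ge1$ and constants $c_1,\dots,c_k\in\mathbb C$ (possibly zero) with $d_{N}=c_1d_{N-1}+\dots+c_kd_{N-k}$ for all $N\ge k$. *)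

theory Defs
  imports
    "HOL-Analysis.Finite_Cartesian_Product"
    "HOL-Analysis.Cartesian_Space"
    "HOL-Library.Poly_Mapping"
    "HOL-Library.Option_ord"
    "HOL-Computational_Algebra.Fraction_Field"
begin

text \<open>
  Polynomials over the complex numbers in variables indexed by a finite type: finitely supported
  coefficient functions on monomials, a monomial being its finitely supported exponent function.
  The affine coordinates are indexed by a type \<open>'n\<close>, the homogeneous coordinates by
  \<open>'n option\<close>, where \<open>None\<close> stands for the additional last coordinate.
  Linear orders on index types (\<open>Option_ord\<close> supplies the one on \<open>'n option\<close>) are needed only
  because the library's integral domain instance for \<^typ>\<open>('v \<Rightarrow>\<^sub>0 nat) \<Rightarrow>\<^sub>0 complex\<close> asks for one.
\<close>

type_synonym 'v cpoly = "('v \<Rightarrow>\<^sub>0 nat) \<Rightarrow>\<^sub>0 complex"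

type_synonym 'v crat = "'v cpoly fract"

definition const_poly :: "complex \<Rightarrow> 'v cpoly" where
  "const_poly c = Poly_Mapping.single 0 c"

definition var_poly :: "'v \<Rightarrow> 'v cpoly" where
  "var_poly v = Poly_Mapping.single (Poly_Mapping.single v 1) 1"

definition rat_of_poly :: "'v::{finite,linorder} cpoly \<Rightarrow> 'v crat" where
  "rat_of_poly p = Fract p 1"

definition homogeneous :: "nat \<Rightarrow> 'v::finite cpoly \<Rightarrow> bool" where
  "homogeneous d p \<longleftrightarrow>
     (\<forall>m \<in> Poly_Mapping.keys p. (\<Sum>v\<in>UNIV. Poly_Mapping.lookup m v) = d)"

text \<open>Evaluation of \<open>p\<close> at \<open>g\<close>, with coefficients mapped to the target ring by \<open>h\<close>.\<close>

definition eval_poly ::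
    "(complex \<Rightarrow> 'r::comm_semiring_1) \<Rightarrow> ('v::finite \<Rightarrow> 'r) \<Rightarrow> 'v cpoly \<Rightarrow> 'r" where
  "eval_poly h g p =
     (\<Sum>m \<in> Poly_Mapping.keys p.
        h (Poly_Mapping.lookup p m) * (\<Prod>v\<in>UNIV. g v ^ Poly_Mapping.lookup m v))"

definition subst_poly :: "('v::finite \<Rightarrow> 'w cpoly) \<Rightarrow> 'v cpoly \<Rightarrow> 'w cpoly" where
  "subst_poly g p = eval_poly const_poly g p"

text \<open>
  Substitution into a rational function. The value does not depend on the chosen
  representation as a fraction, provided that some representation has a denominator that does
  not vanish under the substitution; otherwise it is unspecified.
\<close>

definition subst_rat ::
    "('v::{finite,linorder} \<Rightarrow> 'w::{finite,linorder} crat) \<Rightarrow> 'v crat \<Rightarrow> 'w crat" where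
  "subst_rat g r =
     (let ev = eval_poly (\<lambda>c. rat_of_poly (const_poly c)) g
      in THE s. \<exists>a b. b \<noteq> 0 \<and> r = Fract a b \<and> ev b \<noteq> 0 \<and> s = ev a / ev b)"

text \<open>The zero tuple does not satisfy the following predicate, since \<open>0\<close> divides all its entries.\<close>

definition no_common_factor :: "('i \<Rightarrow> 'v::{finite,linorder} cpoly) \<Rightarrow> bool" where
  "no_common_factor p \<longleftrightarrow> (\<forall>q. (\<forall>i. q dvd p i) \<longrightarrow> q dvd 1)"

text \<open>
  The affine rational map \<open>y\<close> is given by its components, which are rational functions. The tuple
  chosen is unique up to a nonzero complex scalar, i.e. as a tuple of homogeneous coordinates.
\<close>

definition projectivization ::
    "('n::{finite,linorder} \<Rightarrow> 'n crat) \<Rightarrow> 'n option \<Rightarrow> 'n option cpoly" where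
  "projectivization y =
     (SOME p. (\<exists>d. \<forall>i. homogeneous d (p i)) \<and> no_common_factor p \<and> p None \<noteq> 0 \<and>
        (\<forall>i. rat_of_poly (p (Some i)) / rat_of_poly (p None) =
             subst_rat (\<lambda>j. rat_of_poly (var_poly (Some j)) / rat_of_poly (var_poly None)) (y i)))"

definition map_degree :: "('v::finite \<Rightarrow> 'v cpoly) \<Rightarrow> nat" where
  "map_degree p = (THE d. \<forall>i. homogeneous d (p i))"

text \<open>
  Again unique up to a nonzero scalar, for every tuple \<open>F\<close> other than zero. If the entries of \<open>F\<close>
  are homogeneous of the same degree, then so are those of the result.
\<close>

definition remove_common_factors ::
    "('i \<Rightarrow> 'v::{finite,linorder} cpoly) \<Rightarrow> 'i \<Rightarrow> 'v cpoly" where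
  "remove_common_factors F =
     (SOME p. no_common_factor p \<and> (\<exists>q. q \<noteq> 0 \<and> (\<forall>i. F i = q * p i)))"

definition map_comp_proj ::
    "('v::{finite,linorder} \<Rightarrow> 'v cpoly) \<Rightarrow> ('v \<Rightarrow> 'v cpoly) \<Rightarrow> 'v \<Rightarrow> 'v cpoly" where
  "map_comp_proj f g = remove_common_factors (\<lambda>i. subst_poly g (f i))"

primrec map_power ::
    "('v::{finite,linorder} \<Rightarrow> 'v cpoly) \<Rightarrow> nat \<Rightarrow> 'v \<Rightarrow> 'v cpoly" where
  "map_power f 0 = var_poly"
| "map_power f (Suc N) = map_comp_proj f (map_power f N)"

definition affine_monomial_map ::
    "((int, 'n) vec, 'n) vec \<Rightarrow> 'n::{finite,linorder} \<Rightarrow> 'n crat" where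
  "affine_monomial_map A i = (\<Prod>j\<in>UNIV. rat_of_poly (var_poly j) powi (A $ i $ j))"

definition satisfies_linear_recurrence :: "(nat \<Rightarrow> complex) \<Rightarrow> bool" where
  "satisfies_linear_recurrence d \<longleftrightarrow>
     (\<exists>k\<ge>1. \<exists>c. \<forall>N\<ge>k. d N = (\<Sum>i=1..k. c i * d (N - i)))"

lemma affine_monomial_map_3:
  "affine_monomial_map (A :: int^3^3) i =
     rat_of_poly (var_poly 1) powi (A $ i $ 1) * rat_of_poly (var_poly 2) powi (A $ i $ 2) *
     rat_of_poly (var_poly 3) powi (A $ i $ 3)"
  unfolding affine_monomial_map_def UNIV_3 by (simp add: mult.assoc)

lemma affine_monomial_map_example:
  fixes A :: "int^3^3"
  defines "A \<equiv> vector [vector [-1, 1, 0], vector [-1, 0, 1], vector [1, 0, 0]]"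
  defines "x \<equiv> rat_of_poly (var_poly 1)" and "y \<equiv> rat_of_poly (var_poly 2)"
    and "z \<equiv> rat_of_poly (var_poly 3)"
  shows "affine_monomial_map A 1 = y / x"
    and "affine_monomial_map A 2 = z / x"
    and "affine_monomial_map A 3 = x"
  unfolding affine_monomial_map_3 A_def x_def y_def z_def
  by (simp_all add: power_int_minus divide_inverse mult.commute)

end

theory Submission
  imports Defs "HOL-Analysis.Analysis"
begin

text \<open>
  The degree of a monomial map is a column_degreewise linear function of its exponents. In homogeneous
  coordinates the \<open>N\<close>-th iterate has entries that are monomials with exponents read off from
  \<open>A\<^sup>N\<close>, and clearing denominators multiplies them by each coordinate to the power of the largest
  exponent with which it occurs in a denominator. So the degree is a sum, over the four columns of
  the exponent matrix, of maxima of linear functions (\<open>degree_of_monomial_map_power\<close>). Each column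
  evolves under \<open>A\<close>, whose characteristic polynomial \<open>t\<^sup>3 + t\<^sup>2 + t - 1\<close> has a real root \<open>\<rho>\<close> between
  0 and 1 and two complex conjugate roots \<open>\<mu>\<close> and \<open>cnj \<mu>\<close> of modulus greater than 1. Up to an
  exponentially small error the \<open>N\<close>-th degree is therefore \<open>G (\<mu>\<^sup>N)\<close>, where \<open>G\<close> is a sum of
  functions \<open>z \<mapsto> max {Re (w z) | w \<in> W}\<close>, one finite set \<open>W\<close> of complex numbers for each column.

  Assume that the degrees satisfy a linear recurrence. No power \<open>\<mu>\<^sup>m\<close> with \<open>m \<ge> 1\<close> is real, so the
  directions of the powers of \<open>\<mu>\<close> are dense in the circle, and passing to the limit turns the
  recurrence into a functional equation \<open>G z = (\<Sum>i=1..k. b\<^sub>i G (z / \<mu>\<^sup>i))\<close> for all \<open>z\<close>. Look at the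
  kinks of \<open>G\<close>, the points near which it is not affine. By the functional equation, if \<open>z\<close> is a
  kink then so is some \<open>z / \<mu>\<^sup>i\<close> with \<open>1 \<le> i \<le> k\<close>, hence infinitely many \<open>z / \<mu>\<^sup>j\<close> are kinks. But
  all kinks lie on finitely many lines through 0, and if \<open>z \<noteq> 0\<close>, two of the points \<open>z / \<mu>\<^sup>j\<close> on the
  same line make a power of \<open>\<mu>\<close> real. So \<open>G\<close> has no kinks outside 0, which forces each set \<open>W\<close> to be
  a single point (\<open>not_linear_recurrence_if_polygons\<close>). In the example one of these sets contains
  0 and a nonzero number.

  That the powers of \<open>\<mu>\<close> are not real is arithmetic. Reduction modulo the characteristic
  polynomial gives integers with \<open>\<mu>\<^sup>m = a + b \<mu> + c \<mu>\<^sup>2\<close>, and the same integers serve \<open>\<rho>\<close>. If \<open>\<mu>\<^sup>m\<close>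
  is real then irrationality of \<open>\<rho>\<close> forces \<open>b = c = 0\<close>, so that \<open>\<rho>\<^sup>m = a\<close> is an integer strictly
  between 0 and 1.
\<close>

section \<open>Monomials and their factors\<close>

abbreviation "lookup \<equiv> Poly_Mapping.lookup"
abbreviation "keys \<equiv> Poly_Mapping.keys"
abbreviation "single \<equiv> Poly_Mapping.single"

lemma poly_mapping_eq_sum_single:
  "p = (\<Sum>m\<in>keys p. single m (lookup p m))"
  by (rule poly_mapping_eqI)
     (auto simp: lookup_sum lookup_single when_def in_keys_iff sum.delta'[OF finite_keys])

lemma mult_eq_sum_single:
  fixes p q :: "'k::comm_monoid_add \<Rightarrow>\<^sub>0 'a::comm_semiring_0"
  shows "p * q = (\<Sum>m\<in>keys p. \<Sum>n\<in>keys q. single (m + n) (lookup p m * lookup q n))"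
proof -
  have "p * q = (\<Sum>m\<in>keys p. single m (lookup p m)) * (\<Sum>n\<in>keys q. single n (lookup q n))"
    using poly_mapping_eq_sum_single[of p] poly_mapping_eq_sum_single[of q] by simp
  also have "\<dots> = (\<Sum>m\<in>keys p. \<Sum>n\<in>keys q. single m (lookup p m) * single n (lookup q n))"
    by (rule sum_product)
  finally show ?thesis by (simp add: mult_single)
qed

text \<open>
  No cancellation can occur at an exponent that arises from only one pair of exponents of the
  factors.
\<close>

lemma lookup_mult_unique:
  fixes p q :: "'k::comm_monoid_add \<Rightarrow>\<^sub>0 'a::comm_semiring_0"
  assumes "m \<in> keys p" "n \<in> keys q"
    and "\<And>m' n'. m' \<in> keys p \<Longrightarrow> n' \<in> keys q \<Longrightarrow> m' + n' = m + n \<Longrightarrow> m' = m \<and> n' = n"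
  shows "lookup (p * q) (m + n) = lookup p m * lookup q n"
proof -
  have "lookup (p * q) (m + n) =
      (\<Sum>m'\<in>keys p. \<Sum>n'\<in>keys q. if m' + n' = m + n then lookup p m' * lookup q n' else 0)"
    by (subst mult_eq_sum_single) (simp add: lookup_sum lookup_single when_def)
  also have "\<dots> = (\<Sum>m'\<in>keys p. \<Sum>n'\<in>keys q.
      if m' = m then if n' = n then lookup p m * lookup q n else 0 else 0)"
    using assms(3) by (intro sum.cong refl) (auto)
  also have "\<dots> = (\<Sum>m'\<in>keys p. if m' = m then lookup p m * lookup q n else 0)"
    using assms(2) by (intro sum.cong refl) (simp add: sum.delta)
  also have "\<dots> = lookup p m * lookup q n"
    using assms(1) by (simp add: sum.delta)
  finally show ?thesis .
qed

text \<open>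
  In an ordered monoid of exponents, the sum of the two largest and the sum of the two smallest
  exponents of the factors both survive in the product. If the product has only one exponent, these
  sums agree, so that each factor has only one exponent as well.
\<close>

lemma factor_of_monomial:
  fixes p q :: "'k::{ordered_cancel_comm_monoid_add, linorder} \<Rightarrow>\<^sub>0 'a::idom"
  assumes "p * q = single e c" "c \<noteq> 0"
  obtains m a where "p = single m a" "a \<noteq> 0"
proof -
  have nz: "p \<noteq> 0" "q \<noteq> 0"
    using assms by (metis keys_single keys_zero insert_not_empty mult_zero_left mult_zero_right)+
  then have ne: "keys p \<noteq> {}" "keys q \<noteq> {}"
    by (metis lookup_zero not_in_keys_iff_lookup_eq_zero poly_mapping_eqI empty_iff)+
  let ?M = "Max (keys p)" and ?N = "Max (keys q)" and ?m = "Min (keys p)" and ?n = "Min (keys q)"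
  have in_keys: "?M \<in> keys p" "?N \<in> keys q" "?m \<in> keys p" "?n \<in> keys q"
    using ne by auto
  have eq: "a = b \<and> a' = b'" if "a \<le> b" "a' \<le> b'" "a + a' = b + b'" for a b a' b' :: 'k
    using that by (metis add_less_le_mono add_le_less_mono order.not_eq_order_implies_strict less_irrefl)
  have "lookup (p * q) (?M + ?N) = lookup p ?M * lookup q ?N"
    using in_keys by (intro lookup_mult_unique eq) auto
  moreover have "lookup (p * q) (?m + ?n) = lookup p ?m * lookup q ?n"
    using in_keys eq[of ?m _ ?n]  by (intro lookup_mult_unique) (metis Min_le finite_keys)+
  ultimately have "lookup (p * q) (?M + ?N) \<noteq> 0" "lookup (p * q) (?m + ?n) \<noteq> 0"
    using in_keys by (auto simp: in_keys_iff)
  then have "?m + ?n = ?M + ?N"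
    using assms by (auto simp: lookup_single when_def split: if_splits)
  moreover have "?m \<le> ?M" "?n \<le> ?N"
    using in_keys by auto
  ultimately have "?m = ?M" using eq by blast
  then have "keys p = {?M}"
    using ne by (metis Max_ge Min_le finite_keys order_antisym is_singletonI' is_singleton_def in_keys(1) singletonD)
  then have "p = single ?M (lookup p ?M)"
    by (intro poly_mapping_eqI) (metis in_keys_iff lookup_single_eq lookup_single_not_eq singletonD)
  with in_keys show ?thesis using that by (metis in_keys_iff)
qed

lemma prod_single:
  "(\<Prod>w\<in>S. single (a w) (b w)) = single (\<Sum>w\<in>S. a w) (\<Prod>w\<in>S. b w :: 'a::comm_semiring_1)"
  by (induction S rule: infinite_finite_induct) (simp_all add: mult_single)

lemma single_power:
  "single a b ^ n = single (\<Sum>k<n. a) (b ^ n :: 'a::comm_semiring_1)"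
  by (induction n) (simp_all add: mult_single add.commute)

lemma single_eq_prod_var_poly:
  fixes e :: "'v::finite \<Rightarrow>\<^sub>0 nat"
  shows "single e c = const_poly c * (\<Prod>v\<in>UNIV. var_poly v ^ lookup e v)"
proof -
  have "(\<Sum>v\<in>UNIV. \<Sum>k<lookup e v. single v (1::nat)) = e"
    by (rule poly_mapping_eqI)
       (simp add: lookup_sum lookup_single when_def if_distrib[of "\<lambda>x. _ * x"] cong: if_cong)
  then show ?thesis
    by (simp add: const_poly_def var_poly_def single_power prod_single mult_single)
qed

section \<open>Substitution into polynomials and rational functions\<close>

text \<open>
  Evaluation of polynomials is used with values in polynomials and with values in rational
  functions; in both cases the coefficients are mapped by a homomorphism of semirings.
\<close>

locale coeff_hom =
  fixes h :: "complex \<Rightarrow> 'r::comm_semiring_1"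
  assumes hom_0: "h 0 = 0" and hom_1: "h 1 = 1"
    and hom_add: "h (a + b) = h a + h b" and hom_mult: "h (a * b) = h a * h b"
begin

lemma eval_poly_single:
  "eval_poly h g (single m c) = h c * (\<Prod>v\<in>UNIV. g v ^ lookup m v)"
  by (simp add: eval_poly_def hom_0)

lemma eval_poly_superset:
  assumes "finite S" "keys p \<subseteq> S"
  shows "eval_poly h g p = (\<Sum>m\<in>S. h (lookup p m) * (\<Prod>v\<in>UNIV. g v ^ lookup m v))"
  unfolding eval_poly_def using assms
  by (intro sum.mono_neutral_left) (auto simp: in_keys_iff hom_0)

lemma eval_poly_0 [simp]: "eval_poly h g 0 = 0"
  by (simp add: eval_poly_def)

lemma eval_poly_add: "eval_poly h g (p + q) = eval_poly h g p + eval_poly h g q"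
proof -
  have "finite (keys p \<union> keys q)" "keys (p + q) \<subseteq> keys p \<union> keys q"
    using keys_add[of p q] by auto
  then show ?thesis
    using eval_poly_superset[of "keys p \<union> keys q" p g] eval_poly_superset[of "keys p \<union> keys q" q g]
      eval_poly_superset[of "keys p \<union> keys q" "p + q" g]
    by (simp add: lookup_add hom_add distrib_right sum.distrib)
qed

lemma eval_poly_sum: "eval_poly h g (\<Sum>i\<in>I. p i) = (\<Sum>i\<in>I. eval_poly h g (p i))"
  by (induction I rule: infinite_finite_induct) (simp_all add: eval_poly_add)

lemma eval_poly_mult: "eval_poly h g (p * q) = eval_poly h g p * eval_poly h g q"
proof -
  have "eval_poly h g (p * q) = (\<Sum>m\<in>keys p. \<Sum>n\<in>keys q.
      h (lookup p m) * (\<Prod>v\<in>UNIV. g v ^ lookup m v) * (h (lookup q n) * (\<Prod>v\<in>UNIV. g v ^ lookup n v)))"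
    by (subst mult_eq_sum_single)
       (simp add: eval_poly_sum eval_poly_single lookup_add power_add prod.distrib hom_mult mult_ac)
  also have "\<dots> = eval_poly h g p * eval_poly h g q"
    unfolding eval_poly_def by (rule sum_product[symmetric])
  finally show ?thesis .
qed

end

lemma const_poly_hom: "coeff_hom const_poly"
  by standard (simp_all add: const_poly_def single_add mult_single)

lemma rat_of_poly_1 [simp]: "rat_of_poly 1 = 1"
  by (simp add: rat_of_poly_def One_fract_def)

lemma rat_of_poly_0 [simp]: "rat_of_poly 0 = 0"
  by (simp add: rat_of_poly_def Zero_fract_def)

lemma rat_of_poly_mult: "rat_of_poly (p * q) = rat_of_poly p * rat_of_poly q"
  by (simp add: rat_of_poly_def)

lemma rat_of_poly_add: "rat_of_poly (p + q) = rat_of_poly p + rat_of_poly q"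
  by (simp add: rat_of_poly_def)

lemma rat_of_poly_power: "rat_of_poly (p ^ n) = rat_of_poly p ^ n"
  by (induction n) (simp_all add: rat_of_poly_mult)

lemma rat_of_poly_prod: "rat_of_poly (\<Prod>i\<in>I. p i) = (\<Prod>i\<in>I. rat_of_poly (p i))"
  by (induction I rule: infinite_finite_induct) (simp_all add: rat_of_poly_mult)

lemma rat_of_poly_eq_iff: "rat_of_poly p = rat_of_poly q \<longleftrightarrow> p = q"
  by (simp add: rat_of_poly_def eq_fract)

lemma Fract_eq_divide: "q \<noteq> 0 \<Longrightarrow> Fract p q = rat_of_poly p / rat_of_poly q"
  by (simp add: rat_of_poly_def)

lemma rat_const_poly_hom: "coeff_hom (\<lambda>c. rat_of_poly (const_poly c))"
  by standard
    (simp_all add: const_poly_def single_add mult_single flip: rat_of_poly_add rat_of_poly_mult)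

text \<open>
  Evaluation is multiplicative, so equal fractions have equal values as soon as neither denominator
  is mapped to zero; this is what makes the definite description in the definition of substitution
  denote the expected quotient.
\<close>

lemma subst_rat_divide:
  fixes g :: "'v::{finite,linorder} \<Rightarrow> 'w::{finite,linorder} crat"
  defines "ev \<equiv> eval_poly (\<lambda>c. rat_of_poly (const_poly c)) g"
  assumes "ev b \<noteq> 0"
  shows "subst_rat g (rat_of_poly a / rat_of_poly b) = ev a / ev b"
proof -
  interpret coeff_hom "\<lambda>c. rat_of_poly (const_poly c) :: 'w crat" by (rule rat_const_poly_hom)
  have b: "b \<noteq> 0" using assms by auto
  have "s = ev a / ev b"
    if "rat_of_poly a / rat_of_poly b = Fract a' b'" "b' \<noteq> 0" "ev b' \<noteq> 0" "s = ev a' / ev b'"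
    for s a' b'
  proof -
    have "Fract a b = Fract a' b'" using that b by (simp add: Fract_eq_divide)
    then have "a * b' = a' * b" using b that by (simp add: eq_fract)
    then have "ev a * ev b' = ev a' * ev b" unfolding ev_def by (metis eval_poly_mult)
    then show ?thesis using that(3) assms(2) by (simp add: that(4) frac_eq_eq)
  qed
  then show ?thesis
    unfolding subst_rat_def Let_def ev_def[symmetric] using b assms(2)
    by (intro the_equality) (use Fract_eq_divide[of b a] in metis)+
qed

section \<open>Tuples of monomials without common factor\<close>

lemma sum_UNIV_option: "(\<Sum>u\<in>UNIV. \<phi> u) = \<phi> None + (\<Sum>j\<in>UNIV. \<phi> (Some j :: 'n::finite option))"
  by (simp add: UNIV_option_conv sum.reindex comp_def)

lemma prod_UNIV_option: "(\<Prod>u\<in>UNIV. \<phi> u) = \<phi> None * (\<Prod>j\<in>UNIV. \<phi> (Some j :: 'n::finite option))"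
  by (simp add: UNIV_option_conv prod.reindex comp_def)

text \<open>
  A common factor is itself a monomial, and some variable occurs in it unless it is constant.
\<close>

lemma no_common_factor_monomials_iff:
  fixes E :: "'i \<Rightarrow> 'v::{finite,linorder} \<Rightarrow>\<^sub>0 nat"
  assumes c: "\<And>i. c i \<noteq> 0"
  shows "no_common_factor (\<lambda>i. single (E i) (c i)) \<longleftrightarrow> (\<forall>v. \<exists>i. lookup (E i) v = 0)"
proof
  assume red: "\<forall>v. \<exists>i. lookup (E i) v = 0"
  have "q dvd 1" if q: "\<forall>i. q dvd single (E i) (c i)" for q
  proof -
    obtain m a where ma: "q = single m a" "a \<noteq> 0"
      using q c factor_of_monomial by (metis dvdE)
    have "lookup m v = 0" for v
    proof -
      obtain i where i: "lookup (E i) v = 0" using red by blast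
      obtain r where r: "q * r = single (E i) (c i)" using q by (metis dvdE)
      then obtain n b where "r = single n b" "b \<noteq> 0"
        using factor_of_monomial[of r q] c by (metis mult.commute)
      then have "single (m + n) (a * b) = single (E i) (c i)"
        using r ma by (simp add: mult_single)
      then have "m + n = E i" using c
        by (metis lookup_single_eq lookup_single_not_eq)
      with i show ?thesis by (metis add_is_0 lookup_add)
    qed
    then have "m = 0" by (intro poly_mapping_eqI) simp
    then have "1 = q * single 0 (1 / a)" using ma by (simp add: mult_single)
    then show ?thesis by (metis dvdI)
  qed
  then show "no_common_factor (\<lambda>i. single (E i) (c i))"
    unfolding no_common_factor_def by blast
next
  assume ncf: "no_common_factor (\<lambda>i. single (E i) (c i))"
  show "\<forall>v. \<exists>i. lookup (E i) v = 0"
  proof (rule ccontr)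
    assume "\<not> ?thesis"
    then obtain v where v: "\<And>i. lookup (E i) v \<noteq> 0" by auto
    have "single (E i) (c i) = var_poly v * single (E i - single v 1) (c i)" for i
    proof -
      have "single v 1 + (E i - single v 1) = E i" using v[of i]
        by (intro poly_mapping_eqI) (auto simp: lookup_add lookup_minus lookup_single when_def)
      then show ?thesis by (simp add: var_poly_def mult_single)
    qed
    then have "var_poly v dvd 1"
      using ncf unfolding no_common_factor_def by (metis dvdI)
    then obtain r where r: "r * var_poly v = 1" by (metis dvdE mult.commute)
    then obtain n b where "r = single n b"
      using factor_of_monomial[of r "var_poly v" 0 1] by (metis single_one zero_neq_one)
    then have "single (n + single v 1) b = 1" using r by (simp add: var_poly_def mult_single)
    then have "n + single v 1 = 0"
      by (metis lookup_one_zero lookup_single_not_eq zero_neq_one)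
    then show False by (metis add_is_0 lookup_add lookup_single_eq lookup_zero zero_neq_one)
  qed
qed

text \<open>
  The exponents \<open>G\<close> are those of the greatest common divisor of the monomials with exponents \<open>E i\<close>.
\<close>

lemma monomials_common_part:
  fixes E :: "'i \<Rightarrow> 'v::finite \<Rightarrow>\<^sub>0 nat"
  obtains G R where "\<And>i. E i = G + R i" "\<And>v. \<exists>i. lookup (R i) v = 0"
proof -
  define l where "l v = (LEAST n. \<exists>i. lookup (E i) v = n)" for v
  define G where "G = Abs_poly_mapping l"
  have G: "lookup G v = l v" for v by (simp add: G_def)
  have le: "l v \<le> lookup (E i) v" for i v unfolding l_def by (rule Least_le) blast
  have ex: "\<exists>i. lookup (E i) v = l v" for v unfolding l_def by (rule LeastI) blast
  have "E i = G + (E i - G)" for i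
    by (rule poly_mapping_eqI) (simp add: lookup_add lookup_minus G le)
  moreover have "\<exists>i. lookup (E i - G) v = 0" for v
    using ex[of v] by (metis G cancel_comm_monoid_add_class.diff_cancel lookup_minus)
  ultimately show ?thesis by (rule that)
qed

text \<open>
  Removing common factors is defined by a choice among all possible results. As all factors of
  monomials are monomials, every choice is again a tuple of monomials, and what is removed has the
  same exponents \<open>G\<close> in all entries.
\<close>

lemma remove_common_factors_monomials:
  fixes E :: "'i \<Rightarrow> 'v::{finite,linorder} \<Rightarrow>\<^sub>0 nat"
  assumes c: "\<And>i. c i \<noteq> 0"
  obtains G R b where "remove_common_factors (\<lambda>i. single (E i) (c i)) = (\<lambda>i. single (R i) (b i))"
    "\<And>i. b i \<noteq> 0" "\<And>i. E i = G + R i" "\<And>v. \<exists>i. lookup (R i) v = 0"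
proof -
  let ?F = "\<lambda>i. single (E i) (c i)"
  let ?P = "\<lambda>p. no_common_factor p \<and> (\<exists>q. q \<noteq> 0 \<and> (\<forall>i. ?F i = q * p i))"
  define p where "p = remove_common_factors ?F"
  have "\<exists>p. ?P p"
  proof -
    obtain G R where GR: "\<And>i. E i = G + R i" "\<And>v. \<exists>i. lookup (R i) v = 0"
      using monomials_common_part[of E] by blast
    have "?P (\<lambda>i. single (R i) (c i))"
    proof (intro conjI exI[of _ "single G 1"])
      show "no_common_factor (\<lambda>i. single (R i) (c i))"
        using no_common_factor_monomials_iff[of c R] c GR(2) by blast
      show "single G (1::complex) \<noteq> 0"
        by (metis lookup_single_eq lookup_zero zero_neq_one)
      show "\<forall>i. ?F i = single G 1 * single (R i) (c i)"
        by (simp add: mult_single GR(1))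
    qed
    then show ?thesis by blast
  qed
  then have "?P p" unfolding p_def remove_common_factors_def by (rule someI_ex)
  then obtain q where ncf: "no_common_factor p" and q: "\<And>i. q * p i = ?F i" by metis
  obtain G a where G: "q = single G a" "a \<noteq> 0"
    using factor_of_monomial[OF q] c by blast
  have "\<exists>m b. p i = single m b \<and> b \<noteq> 0" for i
    using factor_of_monomial[of "p i" q] q[of i] c by (metis mult.commute)
  then obtain R b where p: "\<And>i. p i = single (R i) (b i)" and b: "\<And>i. b i \<noteq> 0" by metis
  have peq: "p = (\<lambda>i. single (R i) (b i))" using p by blast
  have "E i = G + R i" for i
  proof -
    have "single (G + R i) (a * b i) = single (E i) (c i)"
      using q[of i] by (simp add: G p mult_single)
    then show ?thesis using c by (metis lookup_single_eq lookup_single_not_eq)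
  qed
  moreover have "\<And>v. \<exists>i. lookup (R i) v = 0"
    using ncf no_common_factor_monomials_iff[of b R] b peq by blast
  ultimately show ?thesis using peq b that unfolding p_def by blast
qed

text \<open>
  The normal form of all maps considered here: monomials without common factor. The integers \<open>D\<close>
  are the exponents of the affine map \<open>p (Some i) / p None\<close>. They determine the exponents of all
  entries, because some entry has exponent 0 in each variable, and are insensitive to common
  factors.
\<close>

definition reduced_monomials :: "('n option \<Rightarrow> 'v cpoly) \<Rightarrow> ('n \<Rightarrow> 'v \<Rightarrow> int) \<Rightarrow> bool" where
  "reduced_monomials p D \<longleftrightarrow>
     (\<exists>E c. p = (\<lambda>i. single (E i) (c i)) \<and> (\<forall>i. c i \<noteq> 0) \<and> (\<forall>v. \<exists>i. lookup (E i) v = 0) \<and>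
        (\<forall>i v. int (lookup (E (Some i)) v) - int (lookup (E None) v) = D i v))"

text \<open>
  The exponents of the affine monomial map of \<open>A\<close> after substituting \<open>X\<^sub>j / X\<^sub>0\<close> for the affine
  coordinates, where \<open>X\<^sub>0\<close> is the homogeneous coordinate with index \<open>None\<close>.
\<close>

definition projective_exponents :: "((int, 'n::finite) vec, 'n) vec \<Rightarrow> 'n \<Rightarrow> 'n option \<Rightarrow> int" where
  "projective_exponents A i v = (case v of None \<Rightarrow> - (\<Sum>j\<in>UNIV. A $ i $ j) | Some j \<Rightarrow> A $ i $ j)"

lemma sum_projective_exponents: "(\<Sum>v\<in>UNIV. projective_exponents A i v) = 0"
  by (simp add: sum_UNIV_option projective_exponents_def)

lemma projective_exponents_mult:
  "projective_exponents (A ** B) i v = (\<Sum>j\<in>UNIV. A $ i $ j * projective_exponents B j v)"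
proof (cases v)
  case None
  have "(\<Sum>j\<in>UNIV. \<Sum>k\<in>UNIV. A $ i $ j * B $ j $ k) = (\<Sum>k\<in>UNIV. \<Sum>j\<in>UNIV. A $ i $ j * B $ j $ k)"
    by (rule sum.swap)
  then show ?thesis
    by (simp add: None projective_exponents_def matrix_matrix_mult_def sum_distrib_left sum_negf)
next
  case (Some j)
  then show ?thesis by (simp add: projective_exponents_def matrix_matrix_mult_def)
qed

lemma homogeneous_single: "c \<noteq> 0 \<Longrightarrow> homogeneous d (single e c) \<longleftrightarrow> (\<Sum>v\<in>UNIV. lookup e v) = d"
  by (simp add: homogeneous_def)

text \<open>
  The entry with index \<open>None\<close> is the common denominator, so its exponent in a variable is the
  largest exponent needed to clear that variable from the denominators. By \<open>bal\<close> all
  entries have the same degree, which can therefore be read off from this entry.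
\<close>

lemma map_degree_reduced_monomials:
  assumes p: "reduced_monomials p D" and bal: "\<And>i. (\<Sum>v\<in>UNIV. D i v) = 0"
  shows "int (map_degree p) = (\<Sum>v\<in>UNIV. Max (insert 0 (range (\<lambda>i::'n::finite. - D i v))))"
proof -
  obtain E c where E: "p = (\<lambda>i. single (E i) (c i))" "\<And>i. c i \<noteq> 0" "\<And>v. \<exists>i. lookup (E i) v = 0"
    "\<And>i v. int (lookup (E (Some i)) v) - int (lookup (E None) v) = D i v"
    using p unfolding reduced_monomials_def by blast
  let ?s = "\<lambda>i. \<Sum>v\<in>UNIV. lookup (E i) v"
  have s: "?s i = ?s None" for i
  proof (cases i)
    case (Some j)
    have "int (?s (Some j)) - int (?s None) = (\<Sum>v\<in>UNIV. D j v)"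
      by (simp flip: E(4) add: sum_subtractf)
    then have "int (?s (Some j)) = int (?s None)" by (simp add: bal del: of_nat_sum)
    then show ?thesis unfolding Some of_nat_eq_iff .
  qed simp
  have "map_degree p = ?s None"
    unfolding map_degree_def E(1) using E(2) s by (intro the_equality) (auto simp: homogeneous_single)
  moreover have "int (lookup (E None) v) = Max (insert 0 (range (\<lambda>i. - D i v)))" for v
  proof (rule Max_eqI[symmetric])
    fix y assume "y \<in> insert 0 (range (\<lambda>i. - D i v))"
    then consider "y = 0" | i where "y = - D i v" by blast
    then show "y \<le> int (lookup (E None) v)" by cases (simp_all flip: E(4))
  next
    obtain i where i: "lookup (E i) v = 0" using E(3) by blast
    show "int (lookup (E None) v) \<in> insert 0 (range (\<lambda>i. - D i v))"
    proof (cases i)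
      case None
      then show ?thesis using i by simp
    next
      case (Some j)
      then have "int (lookup (E None) v) = - D j v" using i by (simp flip: E(4))
      then show ?thesis by simp
    qed
  qed simp
  ultimately show ?thesis by simp
qed

lemma reduced_monomials_identity:
  "reduced_monomials var_poly (projective_exponents (mat 1 :: ((int, 'n::finite) vec, 'n) vec))"
proof -
  have "\<exists>i::'n option. lookup (single i (1::nat)) v = 0" for v
  proof (cases v)
    case None
    then show ?thesis by (intro exI[of _ "Some undefined"]) (simp add: lookup_single)
  next
    case (Some j)
    then show ?thesis by (intro exI[of _ None]) (simp add: lookup_single)
  qed
  moreover have "int (lookup (single (Some i) 1) v) - int (lookup (single None 1) v) =
      projective_exponents (mat 1 :: ((int, 'n) vec, 'n) vec) i v" for i :: 'n and v
    by (cases v) (auto simp: projective_exponents_def mat_def lookup_single when_def)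
  ultimately show ?thesis
    unfolding reduced_monomials_def
    by (intro exI[of _ "\<lambda>i. single i 1"] exI[of _ "\<lambda>_. 1"]) (auto simp: var_poly_def)
qed

lemma subst_poly_monomial:
  assumes "\<And>w. b w \<noteq> 0" "c \<noteq> 0"
  obtains S k where "subst_poly (\<lambda>w::'w::finite. single (G w) (b w)) (single e c) = single S k" "k \<noteq> 0"
    "\<And>v. lookup S v = (\<Sum>w\<in>UNIV. lookup e w * lookup (G w) v)"
proof -
  interpret coeff_hom "const_poly :: complex \<Rightarrow> 'b cpoly" by (rule const_poly_hom)
  have "subst_poly (\<lambda>w. single (G w) (b w)) (single e c) =
      single (\<Sum>w\<in>UNIV. \<Sum>k<lookup e w. G w) (c * (\<Prod>w\<in>UNIV. b w ^ lookup e w))"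
    by (simp add: subst_poly_def eval_poly_single single_power prod_single const_poly_def mult_single)
  moreover have "c * (\<Prod>w\<in>UNIV. b w ^ lookup e w) \<noteq> 0"
    using assms by simp
  moreover have "lookup (\<Sum>w\<in>UNIV. \<Sum>k<lookup e w. G w) v = (\<Sum>w\<in>UNIV. lookup e w * lookup (G w) v)" for v
    by (simp add: lookup_sum)
  ultimately show ?thesis by (rule that)
qed

text \<open>
  Exponents of a composition are sums over all homogeneous coordinates of products of exponents.
  Since the rows of \<open>projective_exponents A\<close> sum to 0, the coordinate with index \<open>None\<close> can be
  eliminated from such a sum, which leaves the matrix product.
\<close>

lemma reduced_monomials_map_comp:
  fixes A :: "((int, 'n::{finite,linorder}) vec, 'n) vec"
  assumes f: "reduced_monomials f (projective_exponents A)"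
    and g: "reduced_monomials g (projective_exponents B)"
  shows "reduced_monomials (map_comp_proj f g) (projective_exponents (A ** B))"
proof -
  obtain F b where F: "f = (\<lambda>i. single (F i) (b i))" "\<And>i. b i \<noteq> 0"
    "\<And>i v. int (lookup (F (Some i)) v) - int (lookup (F None) v) = projective_exponents A i v"
    using f unfolding reduced_monomials_def by blast
  obtain G c where G: "g = (\<lambda>i. single (G i) (c i))" "\<And>i. c i \<noteq> 0"
    "\<And>i v. int (lookup (G (Some i)) v) - int (lookup (G None) v) = projective_exponents B i v"
    using g unfolding reduced_monomials_def by blast
  have "\<exists>S k. subst_poly g (f i) = single S k \<and> k \<noteq> 0 \<and>
      (\<forall>v. lookup S v = (\<Sum>w\<in>UNIV. lookup (F i) w * lookup (G w) v))" for i
  proof -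
    obtain S k where "subst_poly (\<lambda>w. single (G w) (c w)) (single (F i) (b i)) = single S k" "k \<noteq> 0"
      "\<And>v. lookup S v = (\<Sum>w\<in>UNIV. lookup (F i) w * lookup (G w) v)"
      by (rule subst_poly_monomial[of c "b i" G "F i", OF G(2) F(2)]) blast
    then show ?thesis unfolding F(1) G(1) by blast
  qed
  then have "\<forall>i. \<exists>S k. subst_poly g (f i) = single S k \<and> k \<noteq> 0 \<and>
      (\<forall>v. lookup S v = (\<Sum>w\<in>UNIV. lookup (F i) w * lookup (G w) v))" ..
  then obtain S k where S: "\<And>i. subst_poly g (f i) = single (S i) (k i)" "\<And>i. k i \<noteq> 0"
    "\<And>i v. lookup (S i) v = (\<Sum>w\<in>UNIV. lookup (F i) w * lookup (G w) v)"
    by (auto dest!: choice)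
  obtain H R a where R: "map_comp_proj f g = (\<lambda>i. single (R i) (a i))"
    "\<And>i. a i \<noteq> 0" "\<And>i. S i = H + R i" "\<And>v. \<exists>i. lookup (R i) v = 0"
    unfolding map_comp_proj_def S(1) by (rule remove_common_factors_monomials[of k S, OF S(2)]) blast
  have "int (lookup (R (Some i)) v) - int (lookup (R None) v) = projective_exponents (A ** B) i v" for i v
  proof -
    have "int (lookup (R (Some i)) v) - int (lookup (R None) v) =
        int (lookup (S (Some i)) v) - int (lookup (S None) v)"
      by (simp add: R(3) lookup_add)
    also have "\<dots> = (\<Sum>w\<in>UNIV. projective_exponents A i w * int (lookup (G w) v))"
      by (simp add: S(3) left_diff_distrib sum_subtractf flip: F(3))
    also have "\<dots> = (\<Sum>j\<in>UNIV. A $ i $ j * projective_exponents B j v)"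
      by (simp add: sum_UNIV_option projective_exponents_def[of A] right_diff_distrib sum_subtractf
          sum_distrib_right flip: G(3))
    also have "\<dots> = projective_exponents (A ** B) i v"
      by (rule projective_exponents_mult[symmetric])
    finally show ?thesis .
  qed
  with R show ?thesis unfolding reduced_monomials_def by blast
qed

lemma power_int_eq_divide:
  fixes x :: "'a::field"
  assumes "x \<noteq> 0"
  shows "x powi k = x ^ nat k / x ^ nat (- k)"
  by (simp add: power_int_def divide_inverse power_inverse)

lemma var_poly_nonzero: "var_poly v \<noteq> 0"
  unfolding var_poly_def by (metis lookup_single_eq lookup_zero zero_neq_one)

lemma rat_of_var_nonzero: "rat_of_poly (var_poly v) \<noteq> 0"
  by (metis rat_of_poly_0 rat_of_poly_eq_iff var_poly_nonzero)

lemma rat_of_monomial: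
  fixes e :: "'v::{finite,linorder} \<Rightarrow>\<^sub>0 nat"
  shows "rat_of_poly (single e 1) = (\<Prod>v\<in>UNIV. rat_of_poly (var_poly v) ^ lookup e v)"
proof -
  have "single e 1 = (\<Prod>v\<in>UNIV. var_poly v ^ lookup e v)"
    by (subst single_eq_prod_var_poly) (simp add: const_poly_def)
  then show ?thesis by (simp add: rat_of_poly_prod rat_of_poly_power)
qed

lemma subst_rat_affine_monomial:
  fixes A :: "((int, 'n::{finite,linorder}) vec, 'n) vec" and g :: "'n \<Rightarrow> 'w::{finite,linorder} crat"
  assumes g: "\<And>j. g j \<noteq> 0"
  shows "subst_rat g (affine_monomial_map A i) = (\<Prod>j\<in>UNIV. g j powi (A $ i $ j))"
proof -
  interpret coeff_hom "\<lambda>c. rat_of_poly (const_poly c) :: 'w crat" by (rule rat_const_poly_hom)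
  let ?ev = "eval_poly (\<lambda>c. rat_of_poly (const_poly c)) g"
  define a where "a = Abs_poly_mapping (\<lambda>j. nat (A $ i $ j))"
  define b where "b = Abs_poly_mapping (\<lambda>j. nat (- (A $ i $ j)))"
  have ab: "lookup a j = nat (A $ i $ j)" "lookup b j = nat (- (A $ i $ j))" for j
    by (simp_all add: a_def b_def)
  have ev: "?ev (single e 1) = (\<Prod>j\<in>UNIV. g j ^ lookup e j)" for e
    using hom_1 by (simp add: eval_poly_single)
  have "affine_monomial_map A i = rat_of_poly (single a 1) / rat_of_poly (single b 1)"
    by (simp add: affine_monomial_map_def rat_of_monomial ab power_int_eq_divide rat_of_var_nonzero
        flip: prod_dividef)
  moreover have "?ev (single b 1) \<noteq> 0" using g by (simp add: ev)
  ultimately have "subst_rat g (affine_monomial_map A i) = ?ev (single a 1) / ?ev (single b 1)"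
    by (simp add: subst_rat_divide)
  then show ?thesis by (simp add: ev ab power_int_eq_divide g flip: prod_dividef)
qed

lemma prod_power_int: "(\<Prod>i\<in>I. (x::'a::field) powi k i) = x powi (\<Sum>i\<in>I. k i)" if "x \<noteq> 0"
  using that by (induction I rule: infinite_finite_induct) (simp_all add: power_int_add)

text \<open>
  A tuple with the same ratios as a tuple of coprime monomials is a multiple of it. For a variable
  \<open>v\<close> choose \<open>i\<close> such that \<open>v\<close> does not occur in the monomial with exponents \<open>E i\<close>; then all powers
  of \<open>v\<close> in the monomial with exponents \<open>E i\<^sub>0\<close> divide \<open>p i\<^sub>0\<close>.
\<close>

lemma proportional_to_monomials:
  fixes E :: "'i \<Rightarrow> 'v::{finite,linorder} \<Rightarrow>\<^sub>0 nat"
  assumes red: "\<And>v. \<exists>i. lookup (E i) v = 0"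
    and prp: "\<And>i. p i * single (E i\<^sub>0) 1 = single (E i) 1 * p i\<^sub>0"
  obtains q :: "'v cpoly" where "\<And>i. p i = single (E i) 1 * q"
proof -
  have le: "lookup (E i\<^sub>0) v \<le> lookup e v" if e: "e \<in> keys (p i\<^sub>0)" for e v
  proof -
    obtain i where i: "lookup (E i) v = 0" using red by blast
    have "lookup (single (E i) 1 * p i\<^sub>0) (E i + e) = 1 * lookup (p i\<^sub>0) e"
      using lookup_mult_unique[of "E i" "single (E i) 1" e "p i\<^sub>0"] e by auto
    then have "E i + e \<in> keys (p i * single (E i\<^sub>0) 1)"
      using e by (simp add: prp in_keys_iff)
    then obtain k where "E i + e = k + E i\<^sub>0"
      using keys_mult[of "p i" "single (E i\<^sub>0) 1"] by auto
    then have "lookup (E i) v + lookup e v = lookup k v + lookup (E i\<^sub>0) v" by (metis lookup_add)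
    then show ?thesis using i by simp
  qed
  define q where "q = (\<Sum>e\<in>keys (p i\<^sub>0). single (e - E i\<^sub>0) (lookup (p i\<^sub>0) e))"
  have "single (E i\<^sub>0) 1 * q = (\<Sum>e\<in>keys (p i\<^sub>0). single e (lookup (p i\<^sub>0) e))"
    unfolding q_def sum_distrib_left mult_single
  proof (intro sum.cong refl)
    fix e assume e: "e \<in> keys (p i\<^sub>0)"
    have "E i\<^sub>0 + (e - E i\<^sub>0) = e"
      using le[OF e] by (intro poly_mapping_eqI) (simp add: lookup_add lookup_minus)
    then show "single (E i\<^sub>0 + (e - E i\<^sub>0)) (1 * lookup (p i\<^sub>0) e) = single e (lookup (p i\<^sub>0) e)"
      by simp
  qed
  then have q: "p i\<^sub>0 = single (E i\<^sub>0) 1 * q" using poly_mapping_eq_sum_single[of "p i\<^sub>0"] by simp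
  have nz: "single (E i\<^sub>0) (1::complex) \<noteq> 0" by (metis lookup_single_eq lookup_zero zero_neq_one)
  have "p i = single (E i) 1 * q" for i
  proof -
    have "single (E i\<^sub>0) 1 * p i = single (E i\<^sub>0) 1 * (single (E i) 1 * q)"
      using prp[of i] by (simp add: q mult_ac)
    then show ?thesis using nz by simp
  qed
  then show ?thesis by (rule that)
qed

text \<open>
  The projectivization is defined by a choice among tuples. One of the tuples is given by the
  monomials that result from clearing denominators, and every other one is a multiple of it; having
  no common factor, it is a constant multiple.
\<close>

lemma reduced_monomials_projectivization:
  fixes A :: "((int, 'n::{finite,linorder}) vec, 'n) vec"
  shows "reduced_monomials (projectivization (affine_monomial_map A)) (projective_exponents A)"
proof -
  let ?X = "\<lambda>v :: 'n option. rat_of_poly (var_poly v)"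
  let ?D = "projective_exponents A"
  let ?rat = "\<lambda>i. subst_rat (\<lambda>j. ?X (Some j) / ?X None) (affine_monomial_map A i)"
  let ?P = "\<lambda>p. (\<exists>d. \<forall>i. homogeneous d (p i)) \<and> no_common_factor p \<and> p None \<noteq> 0 \<and>
        (\<forall>i. rat_of_poly (p (Some i)) / rat_of_poly (p None) = ?rat i)"
  have rat: "?rat i = (\<Prod>v\<in>UNIV. ?X v powi ?D i v)" for i
  proof -
    have "?rat i = (\<Prod>j\<in>UNIV. (?X (Some j) / ?X None) powi (A $ i $ j))"
      by (simp add: subst_rat_affine_monomial rat_of_var_nonzero)
    also have "\<dots> = (\<Prod>j\<in>UNIV. ?X (Some j) powi (A $ i $ j)) / ?X None powi (\<Sum>j\<in>UNIV. A $ i $ j)"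
      by (simp add: power_int_divide_distrib prod_dividef prod_power_int rat_of_var_nonzero)
    also have "\<dots> = (\<Prod>v\<in>UNIV. ?X v powi ?D i v)"
      by (simp add: prod_UNIV_option projective_exponents_def power_int_minus divide_inverse)
    finally show ?thesis .
  qed
  \<comment> \<open>The summand independent of \<open>i\<close> only makes all exponents nonnegative; the excess is removed below.\<close>
  define E' where "E' i = Abs_poly_mapping (\<lambda>v. nat ((\<Sum>j\<in>UNIV. \<bar>?D j v\<bar>) +
      (case i of None \<Rightarrow> 0 | Some i \<Rightarrow> ?D i v)))" for i
  have E': "int (lookup (E' (Some i)) v) - int (lookup (E' None) v) = ?D i v" for i v
  proof -
    have "\<bar>?D i v\<bar> \<le> (\<Sum>j\<in>UNIV. \<bar>?D j v\<bar>)" by (rule member_le_sum) auto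
    then have "0 \<le> (\<Sum>j\<in>UNIV. \<bar>?D j v\<bar>) + ?D i v" by linarith
    moreover have "0 \<le> (\<Sum>j\<in>UNIV. \<bar>?D j v\<bar>)" by (simp add: sum_nonneg)
    ultimately show ?thesis by (simp add: E'_def)
  qed
  obtain H E where HE: "\<And>i. E' i = H + E i" and red: "\<And>v. \<exists>i. lookup (E i) v = 0"
    using monomials_common_part[of E'] by blast
  have E: "int (lookup (E (Some i)) v) - int (lookup (E None) v) = ?D i v" for i v
    using E'[of i v] by (simp add: HE lookup_add)
  define m where "m i = single (E i) (1::complex)" for i
  have m_nz: "m i \<noteq> 0" for i unfolding m_def by (metis lookup_single_eq lookup_zero zero_neq_one)
  have m_rat: "rat_of_poly (m (Some i)) / rat_of_poly (m None) = ?rat i" for i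
    unfolding rat m_def rat_of_monomial
    by (simp add: power_int_diff rat_of_var_nonzero power_int_of_nat flip: E prod_dividef)
  have "?P m"
  proof (intro conjI allI)
    have "(\<Sum>v\<in>UNIV. lookup (E i) v) = (\<Sum>v\<in>UNIV. lookup (E None) v)" for i
    proof (cases i)
      case (Some j)
      have "int (\<Sum>v\<in>UNIV. lookup (E (Some j)) v) - int (\<Sum>v\<in>UNIV. lookup (E None) v) =
          (\<Sum>v\<in>UNIV. ?D j v)"
        by (simp flip: E add: sum_subtractf)
      then have "int (\<Sum>v\<in>UNIV. lookup (E (Some j)) v) = int (\<Sum>v\<in>UNIV. lookup (E None) v)"
        by (simp add: sum_projective_exponents del: of_nat_sum)
      then show ?thesis unfolding Some of_nat_eq_iff .
    qed simp
    then show "\<exists>d. \<forall>i. homogeneous d (m i)"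
      by (auto simp: m_def homogeneous_single)
    show "no_common_factor m"
      unfolding m_def using no_common_factor_monomials_iff[of "\<lambda>_. 1" E] red by simp
  qed (use m_nz m_rat in auto)
  then have "\<exists>p. ?P p" by blast
  define p where "p = projectivization (affine_monomial_map A)"
  have "?P p" using \<open>\<exists>p. ?P p\<close> unfolding p_def projectivization_def by (rule someI_ex)
  then have ncf: "no_common_factor p" and nz: "p None \<noteq> 0"
    and p_rat: "\<And>i. rat_of_poly (p (Some i)) / rat_of_poly (p None) = ?rat i" by auto
  have "p i * m None = m i * p None" for i
  proof (cases i)
    case (Some j)
    have "rat_of_poly (p (Some j)) / rat_of_poly (p None) =
        rat_of_poly (m (Some j)) / rat_of_poly (m None)"
      using p_rat m_rat by simp
    then show ?thesis using nz m_nz[of None]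
      by (metis Some Fract_eq_divide eq_fract(1))
  qed (simp add: mult.commute)
  then obtain q where q: "\<And>i. p i = m i * q"
    using proportional_to_monomials[OF red, of p None] unfolding m_def by blast
  then have "q dvd 1" using ncf unfolding no_common_factor_def by simp
  then obtain r where "q * r = single 0 1" by (metis dvdE single_one)
  then obtain n a where a: "q = single n a" "a \<noteq> 0" using factor_of_monomial by (metis zero_neq_one)
  then have p: "p = (\<lambda>i. single (E i + n) a)" by (auto simp: q m_def mult_single)
  moreover have "\<forall>v. \<exists>i. lookup (E i + n) v = 0"
    using ncf no_common_factor_monomials_iff[of "\<lambda>_. a" "\<lambda>i. E i + n"] a unfolding p by blast
  ultimately show ?thesis
    unfolding reduced_monomials_def p_def[symmetric] using a(2) E
    by (intro exI[of _ "\<lambda>i. E i + n"] exI[of _ "\<lambda>_. a"]) (simp add: lookup_add)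
qed

lemma reduced_monomials_map_power:
  fixes A :: "((int, 'n::{finite,linorder}) vec, 'n) vec"
  defines "f \<equiv> projectivization (affine_monomial_map A)"
  shows "reduced_monomials (map_power f N) (projective_exponents (((**) A ^^ N) (mat 1)))"
proof (induction N)
  case 0
  then show ?case by (simp add: reduced_monomials_identity)
next
  case (Suc N)
  then show ?case
    using reduced_monomials_map_comp[OF reduced_monomials_projectivization[of A]] by (simp add: f_def)
qed

text \<open>
  The sum runs over all homogeneous coordinates, and the maximum over the entries of the affine map;
  the number 0 accounts for a coordinate that occurs in no denominator.
\<close>

theorem degree_of_monomial_map_power:
  fixes A :: "((int, 'n::{finite,linorder}) vec, 'n) vec"
  defines "f \<equiv> projectivization (affine_monomial_map A)"
  shows "int (map_degree (map_power f N)) = (\<Sum>v\<in>UNIV. Max (insert 0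
    (range (\<lambda>i. - projective_exponents (((**) A ^^ N) (mat 1)) i v))))"
  unfolding f_def using reduced_monomials_map_power sum_projective_exponents
  by (rule map_degree_reduced_monomials)

section \<open>Maxima of finitely many linear functions\<close>

text \<open>
  The support function of the polygon spanned by the complex conjugates of the elements of \<open>W\<close>.
\<close>

definition support_function :: "complex set \<Rightarrow> complex \<Rightarrow> real" where
  "support_function W z = (MAX w\<in>W. Re (w * z))"

text \<open>
  For convex \<open>G\<close> this says that \<open>G\<close> is affine near \<open>z\<close>. The formulation by second differences
  passes to linear combinations with coefficients of either sign, and by convexity a sum of second
  differences of support functions vanishes only if each of them does.
\<close>

definition locally_affine_at :: "(complex \<Rightarrow> real) \<Rightarrow> complex \<Rightarrow> bool" where
  "locally_affine_at G z \<longleftrightarrow> (\<forall>\<^sub>F v in nhds 0. G (z + v) + G (z - v) = 2 * G z)"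

lemma support_function_ge:
  assumes "finite W" "w \<in> W"
  shows "Re (w * z) \<le> support_function W z"
  unfolding support_function_def using assms by (intro Max_ge) auto

lemma support_function_attained:
  assumes "finite W" "W \<noteq> {}"
  obtains w where "w \<in> W" "support_function W z = Re (w * z)"
proof -
  have "support_function W z \<in> (\<lambda>w. Re (w * z)) ` W"
    unfolding support_function_def using assms by (intro Max_in) auto
  then show ?thesis using that by blast
qed

lemma support_function_eqI:
  assumes "finite W" "w \<in> W" "\<And>u. u \<in> W \<Longrightarrow> Re (u * z) \<le> Re (w * z)"
  shows "support_function W z = Re (w * z)"
  unfolding support_function_def using assms by (intro Max_eqI) auto

lemma support_function_scale:
  assumes "finite W" "W \<noteq> {}" "r \<ge> 0"
  shows "support_function W (of_real r * z) = r * support_function W z"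
proof -
  have Re: "Re (u * (of_real r * z)) = r * Re (u * z)" for u
    by (simp add: algebra_simps)
  obtain w where w: "w \<in> W" "support_function W z = Re (w * z)"
    using support_function_attained assms by blast
  have "support_function W (of_real r * z) = Re (w * (of_real r * z))"
  proof (rule support_function_eqI)
    fix u assume "u \<in> W"
    then have "Re (u * z) \<le> Re (w * z)" using support_function_ge assms w by metis
    then show "Re (u * (of_real r * z)) \<le> Re (w * (of_real r * z))"
      unfolding Re using assms by (rule_tac mult_left_mono)
  qed (use assms w in auto)
  then show ?thesis unfolding Re w .
qed

lemma continuous_support_function:
  assumes "finite W" "W \<noteq> {}"
  shows "continuous_on S (support_function W)"
  using assms
proof (induction W rule: finite_ne_induct)
  case (singleton w)
  then show ?case by (simp add: support_function_def continuous_intros)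
next
  case (insert w W)
  have "support_function (insert w W) = (\<lambda>z. max (Re (w * z)) (support_function W z))"
    using insert by (simp add: support_function_def fun_eq_iff)
  then show ?case using insert by (simp add: continuous_intros)
qed

text \<open>
  Bound the maximum at \<open>z + v\<close> by the value for \<open>w\<close> and the maximum at \<open>z - v\<close> by the value for \<open>u\<close>.
\<close>

lemma support_function_second_difference_ge:
  assumes "finite W" "w \<in> W" "u \<in> W" "Re (w * z) = support_function W z" "Re (u * z) = support_function W z"
  shows "support_function W (z + v) + support_function W (z - v) - 2 * support_function W z
           \<ge> Re ((w - u) * v)"
  using support_function_ge[OF assms(1,2), of "z + v"] support_function_ge[OF assms(1,3), of "z - v"]
    assms(4,5) by (simp add: algebra_simps)

lemma support_function_second_difference_nonneg:
  assumes "finite W" "W \<noteq> {}"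
  shows "support_function W (z + v) + support_function W (z - v) - 2 * support_function W z \<ge> 0"
proof -
  obtain w where "w \<in> W" "support_function W z = Re (w * z)"
    using support_function_attained assms by blast
  then show ?thesis
    using support_function_second_difference_ge[of W w w z v] assms by simp
qed

text \<open>
  Where two different elements of \<open>W\<close> attain the maximum, the second difference in the direction
  \<open>cnj (w - u)\<close> is positive. Where only one element attains it, this element does so in a whole
  neighbourhood, by continuity.
\<close>

lemma locally_affine_at_support_function_iff:
  assumes "finite W" "W \<noteq> {}"
  shows "locally_affine_at (support_function W) z \<longleftrightarrow>
     (\<forall>w\<in>W. \<forall>u\<in>W. Re (w * z) = support_function W z \<longrightarrow> Re (u * z) = support_function W z \<longrightarrow> w = u)"
    (is "_ \<longleftrightarrow> ?unique")
proof
  assume aff: "locally_affine_at (support_function W) z"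
  show ?unique
  proof (intro ballI impI)
    fix w u assume wu: "w \<in> W" "u \<in> W" "Re (w * z) = support_function W z" "Re (u * z) = support_function W z"
    obtain e where e: "e > 0" and eq: "\<And>v. norm v < e \<Longrightarrow>
        support_function W (z + v) + support_function W (z - v) = 2 * support_function W z"
      using aff unfolding locally_affine_at_def eventually_nhds_metric by auto
    show "w = u"
    proof (rule ccontr)
      assume ne: "w \<noteq> u"
      define v where "v = of_real (e / 2 / norm (w - u)) * cnj (w - u)"
      have "norm v < e" using ne e by (simp add: v_def norm_mult norm_divide flip: complex_cnj_diff)
      have "(w - u) * v = of_real (e / 2 / norm (w - u) * (norm (w - u))\<^sup>2)"
        unfolding v_def using complex_norm_square[of "w - u"] by (simp add: mult_ac)
      then have "Re ((w - u) * v) = e / 2 / norm (w - u) * (norm (w - u))\<^sup>2"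
        by (metis Re_complex_of_real)
      then have "Re ((w - u) * v) > 0" using ne e by simp
      then show False
        using support_function_second_difference_ge[OF assms(1) wu, of v] eq[OF \<open>norm v < e\<close>] by simp
    qed
  qed
next
  assume uniq: ?unique
  obtain w where w: "w \<in> W" "support_function W z = Re (w * z)"
    using support_function_attained assms by blast
  have "\<forall>\<^sub>F y in nhds z. \<forall>u\<in>W. Re (u * y) \<le> Re (w * y)"
  proof (intro eventually_ball_finite assms ballI)
    fix u assume u: "u \<in> W"
    show "\<forall>\<^sub>F y in nhds z. Re (u * y) \<le> Re (w * y)"
    proof (cases "u = w")
      case False
      then have "Re (u * z) < Re (w * z)"
        using uniq u w support_function_ge[OF assms(1) u, of z] by force
      moreover have "((\<lambda>y. Re (w * y) - Re (u * y)) \<longlongrightarrow> Re (w * z) - Re (u * z)) (nhds z)"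
        by (intro tendsto_intros filterlim_ident)
      ultimately have "\<forall>\<^sub>F y in nhds z. 0 < Re (w * y) - Re (u * y)"
        by (intro order_tendstoD) auto
      then show ?thesis by eventually_elim simp
    qed simp
  qed
  then have near: "\<forall>\<^sub>F y in nhds z. support_function W y = Re (w * y)"
    by eventually_elim (rule support_function_eqI[OF assms(1) w(1)], blast)
  have "filterlim (\<lambda>v. z + v) (nhds z) (nhds 0)" "filterlim (\<lambda>v. z - v) (nhds z) (nhds 0)"
    by (auto intro!: tendsto_eq_intros filterlim_ident)
  then have "\<forall>\<^sub>F v in nhds 0. support_function W (z + v) = Re (w * (z + v))"
    "\<forall>\<^sub>F v in nhds 0. support_function W (z - v) = Re (w * (z - v))"
    using near by (auto dest: eventually_compose_filterlim)
  then show "locally_affine_at (support_function W) z"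
    unfolding locally_affine_at_def by eventually_elim (simp add: w algebra_simps)
qed

lemma locally_affine_at_sum_support_functions_iff:
  assumes "finite I" "\<And>i. i \<in> I \<Longrightarrow> finite (W i) \<and> W i \<noteq> {}"
  shows "locally_affine_at (\<lambda>z. \<Sum>i\<in>I. support_function (W i) z) z \<longleftrightarrow>
     (\<forall>i\<in>I. locally_affine_at (support_function (W i)) z)"
proof -
  define \<Delta> where "\<Delta> i v = support_function (W i) (z + v) + support_function (W i) (z - v)
       - 2 * support_function (W i) z" for i v
  have "(\<Sum>i\<in>I. support_function (W i) (z + v)) + (\<Sum>i\<in>I. support_function (W i) (z - v))
       = 2 * (\<Sum>i\<in>I. support_function (W i) z) \<longleftrightarrow> (\<forall>i\<in>I. \<Delta> i v = 0)" (is "?L v \<longleftrightarrow> ?R v") for v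
  proof -
    have "?L v \<longleftrightarrow> (\<Sum>i\<in>I. \<Delta> i v) = 0"
      by (simp add: \<Delta>_def sum.distrib sum_subtractf sum_distrib_left)
    also have "\<dots> \<longleftrightarrow> ?R v"
      using assms support_function_second_difference_nonneg
      by (intro sum_nonneg_eq_0_iff) (auto simp: \<Delta>_def)
    finally show ?thesis .
  qed
  then show ?thesis
    unfolding locally_affine_at_def
    using eventually_ball_finite_distrib[OF assms(1), of "\<lambda>v i. \<Delta> i v = 0" "nhds 0"]
    by (simp add: \<Delta>_def)
qed

text \<open>
  For each \<open>w\<close> the set of nonzero points where \<open>w\<close> attains the maximum is closed in the punctured
  plane. If the maximum is always attained only once, these finitely many sets are disjoint, and
  since the punctured plane is connected, one of them is everything. An element \<open>w\<close> that attains the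
  maximum everywhere is the only one.
\<close>

lemma singleton_if_locally_affine:
  assumes "finite W" "W \<noteq> {}"
    and aff: "\<And>z. z \<noteq> 0 \<Longrightarrow> locally_affine_at (support_function W) z"
  shows "\<exists>w. W = {w}"
proof -
  define F where "F w = {z. z \<noteq> 0 \<and> support_function W z = Re (w * z)}" for w
  have closed: "closedin (top_of_set (- {0})) (F w)" for w
  proof -
    have "closedin (top_of_set (- {0})) {z \<in> - {0}. support_function W z - Re (w * z) = 0}"
      by (intro continuous_closedin_preimage_constant continuous_intros
            continuous_support_function assms)
    moreover have "{z \<in> - {0}. support_function W z - Re (w * z) = 0} = F w" by (auto simp: F_def)
    ultimately show ?thesis by simp
  qed
  have disj: "w = u" if "z \<in> F w" "z \<in> F u" "w \<in> W" "u \<in> W" for w u z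
    using that aff[of z] locally_affine_at_support_function_iff[OF assms(1,2), of z] by (auto simp: F_def)
  obtain w where w: "w \<in> W" "support_function W 1 = Re (w * 1)"
    using support_function_attained assms by blast
  have conn: "connected (- {0::complex})"
    using connected_punctured_universe[where 'N = complex] by simp
  have cover: "- {0} \<subseteq> F w \<union> \<Union>(F ` (W - {w}))"
  proof
    fix z :: complex assume "z \<in> - {0}"
    moreover obtain u where "u \<in> W" "support_function W z = Re (u * z)"
      using support_function_attained assms by blast
    ultimately show "z \<in> F w \<union> \<Union>(F ` (W - {w}))" by (auto simp: F_def)
  qed
  have "\<Union>(F ` (W - {w})) = {}"
  proof (rule ccontr)
    assume ne: "\<Union>(F ` (W - {w})) \<noteq> {}"
    have "closedin (top_of_set (- {0})) (\<Union>(F ` (W - {w})))"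
      using closed assms(1) by (intro closedin_Union) auto
    moreover have "F w \<inter> \<Union>(F ` (W - {w})) = {}" using disj w by blast
    moreover have "1 \<in> F w" using w by (simp add: F_def)
    ultimately show False
      using conn cover closed[of w] ne unfolding connected_closedin by blast
  qed
  then have F_all: "\<And>z. z \<noteq> 0 \<Longrightarrow> z \<in> F w" using cover by auto
  have "u = w" if u: "u \<in> W" for u
  proof (rule ccontr)
    assume ne: "u \<noteq> w"
    \<comment> \<open>In the direction \<open>cnj (u - w)\<close> the element \<open>u\<close> beats \<open>w\<close>.\<close>
    have "cnj (u - w) \<noteq> 0" using ne by (metis complex_cnj_zero_iff right_minus_eq)
    then have "cnj (u - w) \<in> F w" by (rule F_all)
    then have "Re (u * cnj (u - w)) \<le> Re (w * cnj (u - w))"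
      using support_function_ge[OF assms(1) u, of "cnj (u - w)"] by (simp add: F_def)
    then have "Re ((u - w) * cnj (u - w)) \<le> 0" by (simp add: algebra_simps)
    then show False using ne by (metis Re_complex_of_real complex_norm_square not_le right_minus_eq zero_less_norm_iff zero_less_power)
  qed
  then show ?thesis using w by blast
qed

text \<open>
  Kronecker's approximation theorem gives one power of \<open>u\<close> near a given point of the circle.
  Approximating \<open>z / u ^ M\<close> in place of \<open>z\<close> makes the exponent at least \<open>M\<close>.
\<close>

lemma dense_powers:
  fixes u z :: complex
  assumes "norm u = 1" "\<And>m::nat. m \<ge> 1 \<Longrightarrow> u ^ m \<noteq> 1" "norm z = 1" "e > 0"
  obtains n where "n \<ge> M" "norm (u ^ n - z) < e"
proof -
  define \<theta> where "\<theta> = Arg u / (2 * pi)"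
  have u: "u = cis (2 * pi * \<theta>)"
    using cis_Arg[of u] assms(1) by (cases "u = 0") (auto simp: \<theta>_def sgn_div_norm)
  have u_pow: "u ^ n = cis (2 * pi * (real n * \<theta>))" for n
  proof -
    have "u ^ n = cis (real n * (2 * pi * \<theta>))" unfolding u by (rule Complex.DeMoivre)
    also have "real n * (2 * pi * \<theta>) = 2 * pi * (real n * \<theta>)" by simp
    finally show ?thesis .
  qed
  have "\<theta> \<notin> \<rat>"
  proof
    assume "\<theta> \<in> \<rat>"
    then obtain a b :: int where ab: "b > 0" "\<theta> = of_int a / of_int b" by (meson Rats_cases')
    then have "u ^ nat b = cis (2 * pi * of_int a)" by (simp add: u_pow)
    also have "\<dots> = 1" by simp
    finally show False using assms(2)[of "nat b"] ab by simp
  qed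
  define y where "y = z / u ^ M"
  have ny: "norm y = 1" using assms by (simp add: y_def norm_divide norm_power)
  define \<alpha> where "\<alpha> = Arg y / (2 * pi)"
  have y: "y = cis (2 * pi * \<alpha>)"
    using cis_Arg[of y] ny by (cases "y = 0") (auto simp: \<alpha>_def sgn_div_norm)
  have "isCont (\<lambda>t. cis (2 * pi * t)) \<alpha>" unfolding cis_conv_exp by (intro continuous_intros)
  then obtain \<delta> where \<delta>: "\<delta> > 0" "\<And>t. \<bar>t - \<alpha>\<bar> < \<delta> \<Longrightarrow> norm (cis (2 * pi * t) - y) < e"
    using \<open>e > 0\<close> unfolding continuous_at_eps_delta y dist_norm real_norm_def by blast
  obtain h k where hk: "k > 0" "\<bar>of_int k * \<theta> - of_int h - \<alpha>\<bar> < \<delta>"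
    using sequence_of_fractional_parts_is_dense[OF \<open>\<theta> \<notin> \<rat>\<close> \<delta>(1)] by metis
  have "cis (2 * pi * (of_int k * \<theta> - of_int h)) = cis (2 * pi * (of_int k * \<theta>)) / cis (2 * pi * of_int h)"
    unfolding cis_divide by (simp only: right_diff_distrib)
  also have "\<dots> = u ^ nat k" using hk by (simp add: u_pow)
  finally have "norm (u ^ nat k - y) < e" using \<delta>(2)[OF hk(2)] by simp
  moreover have "u ^ (nat k + M) - z = (u ^ nat k - y) * u ^ M"
    using assms(1) by (auto simp: y_def power_add left_diff_distrib)
  ultimately have "norm (u ^ (nat k + M) - z) < e" using assms(1) by (simp add: norm_mult norm_power)
  then show ?thesis by (intro that[of "nat k + M"]) auto
qed

text \<open>
  A sequence that is asymptotic to a sum of support functions along the powers of \<open>\<mu>\<close> inherits the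
  kinks of these functions, whereas a linear recurrence would propagate a kink along infinitely many
  of the rotated lines through it.
\<close>

theorem not_linear_recurrence_if_polygons:
  fixes \<mu> :: complex and d :: "nat \<Rightarrow> real" and W :: "'i \<Rightarrow> complex set"
  assumes I: "finite I" "\<And>i. i \<in> I \<Longrightarrow> finite (W i)" "\<And>i. i \<in> I \<Longrightarrow> W i \<noteq> {}"
    and nonreal: "\<And>m. m \<ge> 1 \<Longrightarrow> \<mu> ^ m \<notin> \<real>"
    and asymp: "(\<lambda>n. (d n - (\<Sum>i\<in>I. support_function (W i) (\<mu> ^ n))) / norm \<mu> ^ n) \<longlonglongrightarrow> 0"
    and two: "i \<in> I" "\<not> is_singleton (W i)"
  shows "\<not> satisfies_linear_recurrence (\<lambda>n. of_real (d n))"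
proof
  assume "satisfies_linear_recurrence (\<lambda>n. of_real (d n))"
  then obtain k c where rec: "\<And>N. N \<ge> k \<Longrightarrow> complex_of_real (d N) = (\<Sum>i=1..k. c i * of_real (d (N - i)))"
    unfolding satisfies_linear_recurrence_def by blast
  define b where "b i = Re (c i)" for i
  have rec: "d N = (\<Sum>i=1..k. b i * d (N - i))" if "N \<ge> k" for N
    using arg_cong[OF rec[OF that], of Re] by (simp add: b_def)
  define G where "G z = (\<Sum>i\<in>I. support_function (W i) z)" for z
  have G_scale: "G (of_real r * z) = r * G z" if "r \<ge> 0" for r z
    unfolding G_def sum_distrib_left using I that by (intro sum.cong refl support_function_scale) auto
  have G_cont: "continuous_on UNIV G"
    unfolding G_def using I by (intro continuous_intros continuous_support_function) auto
  have \<mu>: "\<mu> \<noteq> 0" using nonreal[of 1] by auto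
  define R where "R = norm \<mu>"
  have R: "R > 0" using \<mu> by (simp add: R_def)
  define u where "u = \<mu> / of_real R"
  have u_pow: "\<mu> ^ n = of_real (R ^ n) * u ^ n" for n using R by (simp add: u_def power_divide)
  have nu: "norm u = 1" using R by (simp add: u_def norm_divide R_def)
  have u_ne: "u ^ m \<noteq> 1" if "m \<ge> 1" for m
    using nonreal[OF that] u_pow[of m] by auto

  \<comment> \<open>\<open>E\<close> is the defect in the functional equation. It is small at the powers of \<open>u\<close>, by the
    recurrence, hence zero on the circle by density, and zero everywhere by homogeneity.\<close>
  define E where "E z = G z - (\<Sum>i=1..k. b i * G (z / \<mu> ^ i))" for z
  have E_scale: "E (of_real r * z) = r * E z" if "r \<ge> 0" for r z
  proof -
    have "G (of_real r * z / \<mu> ^ i) = r * G (z / \<mu> ^ i)" for i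
      using G_scale[OF that, of "z / \<mu> ^ i"] by simp
    then show ?thesis
      by (simp add: E_def G_scale[OF that] right_diff_distrib sum_distrib_left mult.left_commute)
  qed
  have E_cont: "continuous_on UNIV E"
    unfolding E_def using \<mu>
    by (intro continuous_intros continuous_on_compose2[OF G_cont]) auto
  define \<delta> where "\<delta> n = (d n - G (\<mu> ^ n)) / R ^ n" for n
  have \<delta>: "\<delta> \<longlonglongrightarrow> 0" using asymp by (simp add: \<delta>_def[abs_def] G_def R_def)
  have G_pow: "G (\<mu> ^ n) = d n - R ^ n * \<delta> n" for n using R by (simp add: \<delta>_def)
  have E_pow: "E (u ^ N) = (\<Sum>i=1..k. b i / R ^ i * \<delta> (N - i)) - \<delta> N" if N: "N \<ge> k" for N
  proof -
    have "R ^ N * E (u ^ N) = E (\<mu> ^ N)" using E_scale[of "R ^ N" "u ^ N"] R by (simp add: u_pow)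
    also have "\<dots> = G (\<mu> ^ N) - (\<Sum>i=1..k. b i * G (\<mu> ^ (N - i)))"
      unfolding E_def using N \<mu> by (simp add: power_diff)
    also have "\<dots> = (\<Sum>i=1..k. b i * (R ^ (N - i) * \<delta> (N - i))) - R ^ N * \<delta> N"
      by (simp add: G_pow right_diff_distrib sum_subtractf rec[OF N])
    also have "\<dots> = R ^ N * ((\<Sum>i=1..k. b i / R ^ i * \<delta> (N - i)) - \<delta> N)"
    proof -
      have "b i * (R ^ (N - i) * \<delta> (N - i)) = R ^ N * (b i / R ^ i * \<delta> (N - i))" if "i \<in> {1..k}" for i
        using that N R by (simp add: power_diff)
      then show ?thesis by (simp add: right_diff_distrib sum_distrib_left)
    qed
    finally show ?thesis using R by simp
  qed
  have \<delta>_shift: "(\<lambda>N. \<delta> (N - i)) \<longlonglongrightarrow> 0" for i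
    by (rule filterlim_compose[OF \<delta> filterlim_minus_const_nat_at_top])
  have "(\<lambda>N. (\<Sum>i=1..k. b i / R ^ i * \<delta> (N - i)) - \<delta> N) \<longlonglongrightarrow> (\<Sum>i=1..k. b i / R ^ i * 0) - 0"
    by (intro tendsto_diff tendsto_sum tendsto_mult tendsto_const \<delta>_shift \<delta>)
  then have "(\<lambda>N. (\<Sum>i=1..k. b i / R ^ i * \<delta> (N - i)) - \<delta> N) \<longlonglongrightarrow> 0" by simp
  moreover have "\<forall>\<^sub>F N in sequentially. (\<Sum>i=1..k. b i / R ^ i * \<delta> (N - i)) - \<delta> N = E (u ^ N)"
    by (rule eventually_mono[OF eventually_ge_at_top[of k]]) (rule E_pow[symmetric])
  ultimately have E_lim: "(\<lambda>N. E (u ^ N)) \<longlonglongrightarrow> 0" by (rule Lim_transform_eventually)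
  have E_circle: "E z = 0" if z: "norm z = 1" for z
  proof (rule ccontr)
    assume "E z \<noteq> 0"
    then have pos: "\<bar>E z\<bar> / 2 > 0" by simp
    have "isCont E z" using E_cont by (simp add: continuous_on_eq_continuous_at)
    then obtain s where s: "s > 0" "\<And>y. norm (y - z) < s \<Longrightarrow> \<bar>E y - E z\<bar> < \<bar>E z\<bar> / 2"
      using pos unfolding continuous_at_eps_delta by (metis dist_norm real_norm_def)
    obtain M where M: "\<And>N. N \<ge> M \<Longrightarrow> \<bar>E (u ^ N)\<bar> < \<bar>E z\<bar> / 2"
      using LIMSEQ_D[OF E_lim pos] by auto
    obtain n where "n \<ge> M" "norm (u ^ n - z) < s"
      by (rule dense_powers[OF nu u_ne z s(1), where M = M])
    then have "\<bar>E (u ^ n) - E z\<bar> < \<bar>E z\<bar> / 2" "\<bar>E (u ^ n)\<bar> < \<bar>E z\<bar> / 2"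
      using s(2) M by blast+
    then show False by linarith
  qed
  have E_0: "E z = 0" for z
  proof (cases "z = 0")
    case True
    then show ?thesis using E_scale[of 0 0] by simp
  next
    case False
    then have "E (of_real (norm z) * sgn z) = 0" by (simp add: E_scale E_circle norm_sgn)
    then show ?thesis using False by (simp add: sgn_eq)
  qed
  have G_rec: "G z = (\<Sum>i=1..k. b i * G (z / \<mu> ^ i))" for z
    using E_0[of z] by (simp add: E_def)

  have step: "locally_affine_at G z" if aff: "\<And>i. i \<in> {1..k} \<Longrightarrow> locally_affine_at G (z / \<mu> ^ i)" for z
  proof -
    have "\<forall>\<^sub>F v in nhds 0. G (z / \<mu> ^ i + v / \<mu> ^ i) + G (z / \<mu> ^ i - v / \<mu> ^ i) = 2 * G (z / \<mu> ^ i)"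
      if i: "i \<in> {1..k}" for i
    proof -
      have "filterlim (\<lambda>v. v / \<mu> ^ i) (nhds 0) (nhds 0)"
        using \<mu> by (auto intro!: tendsto_eq_intros filterlim_ident)
      then show ?thesis
        using aff[OF i] unfolding locally_affine_at_def by (auto dest: eventually_compose_filterlim)
    qed
    then have "\<forall>\<^sub>F v in nhds 0. \<forall>i\<in>{1..k}.
        G (z / \<mu> ^ i + v / \<mu> ^ i) + G (z / \<mu> ^ i - v / \<mu> ^ i) = 2 * G (z / \<mu> ^ i)"
      by (intro eventually_ball_finite) auto
    then show ?thesis
      unfolding locally_affine_at_def
    proof eventually_elim
      case (elim v)
      have "G (z + v) + G (z - v) =
          (\<Sum>i=1..k. b i * (G (z / \<mu> ^ i + v / \<mu> ^ i) + G (z / \<mu> ^ i - v / \<mu> ^ i)))"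
        unfolding G_rec[of "z + v"] G_rec[of "z - v"]
        by (simp add: add_divide_distrib diff_divide_distrib distrib_left sum.distrib)
      also have "\<dots> = (\<Sum>i=1..k. b i * (2 * G (z / \<mu> ^ i)))"
        using elim by (intro sum.cong refl) simp
      also have "\<dots> = 2 * G z" by (subst G_rec) (simp add: sum_distrib_left mult_ac)
      finally show ?case .
    qed
  qed
  have affine_iff: "locally_affine_at G z \<longleftrightarrow> (\<forall>i\<in>I. locally_affine_at (support_function (W i)) z)" for z
    unfolding G_def using I by (intro locally_affine_at_sum_support_functions_iff) auto
  have all_affine: "locally_affine_at G z" if z: "z \<noteq> 0" for z
  proof (rule ccontr)
    assume nonaff: "\<not> locally_affine_at G z"
    \<comment> \<open>A kink at \<open>z\<close> spreads to kinks at infinitely many \<open>z / \<mu> ^ j\<close>.\<close>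
    define J where "J = {j. \<not> locally_affine_at G (z / \<mu> ^ j)}"
    have next_J: "\<exists>j'\<in>J. j' > j" if "j \<in> J" for j
    proof -
      obtain i where "i \<in> {1..k}" "\<not> locally_affine_at G (z / \<mu> ^ j / \<mu> ^ i)"
        using step[of "z / \<mu> ^ j"] \<open>j \<in> J\<close> by (auto simp: J_def)
      then show ?thesis by (intro bexI[of _ "j + i"]) (auto simp: J_def power_add)
    qed
    have "infinite J"
    proof
      assume fin: "finite J"
      have "0 \<in> J" using nonaff by (simp add: J_def)
      then have "Max J \<in> J" using Max_in[OF fin] by blast
      then obtain j where "j \<in> J" "j > Max J" using next_J by blast
      then show False using Max_ge[OF fin, of j] by linarith
    qed
    \<comment> \<open>A triple \<open>t\<close> names one of the finitely many lines through 0 that contain all kinks.\<close>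
    define P where "P j t \<longleftrightarrow> t \<in> Sigma I (\<lambda>i. W i \<times> W i) \<and> fst (snd t) \<noteq> snd (snd t) \<and>
       Re ((fst (snd t) - snd (snd t)) * (z / \<mu> ^ j)) = 0" for j t
    have "\<exists>t. P j t" if j: "j \<in> J" for j
    proof -
      define y where "y = z / \<mu> ^ j"
      obtain i where i: "i \<in> I" "\<not> locally_affine_at (support_function (W i)) y"
        using j affine_iff by (auto simp: J_def y_def)
      obtain w w' where w: "w \<in> W i" "w' \<in> W i" "w \<noteq> w'"
        "Re (w * y) = support_function (W i) y" "Re (w' * y) = support_function (W i) y"
        using i(2) unfolding locally_affine_at_support_function_iff[OF I(2,3)[OF i(1)]] by blast
      have "Re ((w - w') * y) = Re (w * y) - Re (w' * y)" by (simp only: left_diff_distrib minus_complex.sel)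
      also have "\<dots> = 0" using w by (simp only: diff_self)
      finally show ?thesis using w i(1) unfolding P_def y_def by (intro exI[of _ "(i, w, w')"]) simp
    qed
    then obtain t where "\<And>j. j \<in> J \<Longrightarrow> P j (t j)" by (metis bchoice)
    then have t: "\<And>j. j \<in> J \<Longrightarrow> t j \<in> Sigma I (\<lambda>i. W i \<times> W i)"
      "\<And>j. j \<in> J \<Longrightarrow> fst (snd (t j)) \<noteq> snd (snd (t j))"
      "\<And>j. j \<in> J \<Longrightarrow> Re ((fst (snd (t j)) - snd (snd (t j))) * (z / \<mu> ^ j)) = 0"
      unfolding P_def by blast+
    have "finite (Sigma I (\<lambda>i. W i \<times> W i))" using I by auto
    then have "\<not> inj_on t J"
      using \<open>infinite J\<close> t(1) by (meson finite_imageD finite_subset image_subsetI)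
    then obtain j j' where jj: "j \<in> J" "j' \<in> J" "j < j'" "t j = t j'"
      unfolding inj_on_def by (metis nat_neq_iff)
    \<comment> \<open>Two kinks on the same line: a power of \<open>\<mu>\<close> is the quotient of two imaginary numbers.\<close>
    define a where "a = (fst (snd (t j)) - snd (snd (t j))) * z"
    have a: "a \<noteq> 0" using t(2)[OF jj(1)] z by (simp add: a_def)
    have "Re (a / \<mu> ^ j) = 0" "Re (a / \<mu> ^ j') = 0"
      using t(3)[OF jj(1)] t(3)[OF jj(2)] jj(4) by (simp_all add: a_def)
    moreover have "Im (p / q) = 0" if "Re p = 0" "Re q = 0" for p q :: complex
      using that by (simp add: Im_divide)
    ultimately have "Im ((a / \<mu> ^ j) / (a / \<mu> ^ j')) = 0" by blast
    moreover have "(a / \<mu> ^ j) / (a / \<mu> ^ j') = \<mu> ^ (j' - j)"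
      using a \<mu> jj(3) by (simp add: power_diff)
    ultimately have "\<mu> ^ (j' - j) \<in> \<real>" by (simp add: complex_is_Real_iff)
    then show False using nonreal[of "j' - j"] jj(3) by simp
  qed
  have "\<exists>w. W i = {w}"
    using I(2,3)[OF two(1)] all_affine affine_iff two(1) by (intro singleton_if_locally_affine) auto
  then show False using two(2) by (simp add: is_singleton_def)
qed

section \<open>The degree sequence of the example\<close>

text \<open>
  The recurrence \<open>t\<^sub>n\<^sub>+\<^sub>3 = t\<^sub>n - t\<^sub>n\<^sub>+\<^sub>1 - t\<^sub>n\<^sub>+\<^sub>2\<close> belongs to the characteristic polynomial of the matrix. Shifting
  the three initial values makes the sequence directly computable.
\<close>

fun cubic_seq :: "int \<Rightarrow> int \<Rightarrow> int \<Rightarrow> nat \<Rightarrow> int" where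
  "cubic_seq a b c 0 = a"
| "cubic_seq a b c (Suc n) = cubic_seq b c (a - b - c) n"

lemma cubic_seq_rec: "cubic_seq a b c (n + 3) = cubic_seq a b c n - cubic_seq a b c (n + 1) - cubic_seq a b c (n + 2)"
proof (induction n arbitrary: a b c)
  case 0
  show ?case by (simp add: numeral_3_eq_3 numeral_2_eq_2)
next
  case (Suc n)
  have "cubic_seq a b c (Suc n + 3) = cubic_seq b c (a - b - c) (n + 3)"
    by (simp only: add_Suc cubic_seq.simps)
  also note Suc
  finally show ?case by (simp only: add_Suc cubic_seq.simps)
qed

lemma cubic_seq_unique:
  assumes "\<And>n. t (n + 3) = t n - t (n + 1) - t (n + 2)"
  shows "t n = cubic_seq (t 0) (t 1) (t 2) n"
proof (induction n rule: less_induct)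
  case (less n)
  show ?case
  proof (cases "n < 3")
    case True
    then have "n = 0 \<or> n = 1 \<or> n = 2" by auto
    then show ?thesis by (auto simp: numeral_2_eq_2)
  next
    case False
    then obtain m where m: "n = m + 3" by (metis add.commute le_Suc_ex not_less)
    show ?thesis
      using less[of m] less[of "m + 1"] less[of "m + 2"] unfolding m assms cubic_seq_rec by simp
  qed
qed

text \<open>
  The contribution of one homogeneous coordinate to the degree. The negated entries of its column
  of exponents are \<open>t\<^sub>n\<close>, \<open>t\<^sub>n\<^sub>+\<^sub>1\<close> and \<open>t\<^sub>n\<^sub>+\<^sub>1 + t\<^sub>n\<^sub>+\<^sub>2\<close>, where \<open>t\<close> is the sequence with the given initial
  values.
\<close>

definition column_degree :: "int \<Rightarrow> int \<Rightarrow> int \<Rightarrow> nat \<Rightarrow> int" where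
  "column_degree a b c n = Max {0, cubic_seq a b c n, cubic_seq a b c (n + 1), cubic_seq a b c (n + 1) + cubic_seq a b c (n + 2)}"

text \<open>
  Multiplication by the matrix on the left makes the first row of exponents the new third row, and
  its formula for the new first row expresses the old second row by first rows. So each column is
  determined by the sequence of its third entries, and the formula for the new second row becomes
  the recurrence for this sequence.
\<close>

lemma degree_sequence:
  fixes A :: "int^3^3"
  assumes A: "A = vector [vector [-1, 1, 0], vector [-1, 0, 1], vector [ 1, 0, 0]]"
    and f: "f = projectivization (affine_monomial_map A)"
  shows "int (map_degree (map_power f N)) =
    column_degree 1 1 0 N + column_degree 0 (-1) 1 N + column_degree 0 0 (-1) N + column_degree (-1) 0 0 N"
proof -
  define P where "P n i v = projective_exponents (((**) A ^^ n) (mat 1)) i v" for n i v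
  define t where "t v n = - P n 3 v" for v n
  have A_nth: "A $ 1 $ 1 = -1" "A $ 1 $ 2 = 1" "A $ 1 $ 3 = 0"
    "A $ 2 $ 1 = -1" "A $ 2 $ 2 = 0" "A $ 2 $ 3 = 1"
    "A $ 3 $ 1 = 1" "A $ 3 $ 2 = 0" "A $ 3 $ 3 = 0" by (simp_all add: A)
  have P_Suc: "P (Suc n) 1 v = P n 2 v - P n 1 v" "P (Suc n) 2 v = P n 3 v - P n 1 v"
    "P (Suc n) 3 v = P n 1 v" for n v
    by (simp_all add: P_def projective_exponents_mult sum_3 A_nth)
  have row1: "- P n 1 v = t v (n + 1)" for v n
    using P_Suc(3)[of n v] by (simp add: t_def)
  have row2: "- P n 2 v = t v (n + 1) + t v (n + 2)" for v n
    using row1[of "Suc n" v] row1[of n v] P_Suc(1)[of n v] by simp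
  have rec: "t v (n + 3) = t v n - t v (n + 1) - t v (n + 2)" for v n
    using row2[of "Suc n" v] row1[of n v] P_Suc(2)[of n v]
    by (simp add: t_def[of v n] numeral_3_eq_3)
  have t: "t v n = cubic_seq (t v 0) (t v 1) (t v 2) n" for v n
    by (rule cubic_seq_unique) (rule rec)
  have P_0: "P 0 i v = projective_exponents (mat 1 :: int^3^3) i v" for i v
    by (simp add: P_def)
  have init: "t v 0 = - P 0 3 v" "t v 1 = - P 0 1 v" "t v 2 = P 0 1 v - P 0 2 v" for v
    using row1[of 0 v] row2[of 0 v] by (simp_all add: t_def[of v 0] numeral_2_eq_2)
  have val: "t None n = cubic_seq 1 1 0 n" "t (Some 1) n = cubic_seq 0 (-1) 1 n"
    "t (Some 2) n = cubic_seq 0 0 (-1) n" "t (Some 3) n = cubic_seq (-1) 0 0 n" for n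
    unfolding t[of _ n] init P_0
    by (simp_all add: projective_exponents_def mat_def sum_3)
  have max: "Max (insert 0 (range (\<lambda>i. - P N i v))) =
     Max {0, t v N, t v (N + 1), t v (N + 1) + t v (N + 2)}" for v
  proof -
    have "range (\<lambda>i. - P N i v) = {t v (N + 1), t v (N + 1) + t v (N + 2), t v N}"
      unfolding UNIV_3 image_insert image_empty row1 row2 t_def[of v N] ..
    then show ?thesis by (simp add: insert_commute)
  qed
  have "int (map_degree (map_power f N)) = (\<Sum>v\<in>UNIV. Max (insert 0 (range (\<lambda>i. - P N i v))))"
    unfolding f degree_of_monomial_map_power P_def ..
  also have "\<dots> = column_degree 1 1 0 N + column_degree 0 (-1) 1 N + column_degree 0 0 (-1) N + column_degree (-1) 0 0 N"
    unfolding max column_degree_def sum_UNIV_option sum_3 val by simp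
  finally show ?thesis .
qed

lemma degree_values:
  "map (\<lambda>N. column_degree 1 1 0 N + column_degree 0 (-1) 1 N + column_degree 0 0 (-1) N + column_degree (-1) 0 0 N) [0..<21] =
   [1, 2, 3, 4, 6, 9, 12, 17, 25, 33, 45, 65, 85, 112, 159, 215, 262, 365, 524, 627, 833]"
  by code_simp

section \<open>The eigenvalues of the example\<close>

text \<open>
  The equation for \<open>\<mu>\<close> is the quotient of the characteristic polynomial by \<open>t - \<rho>\<close>.
\<close>

locale characteristic_roots =
  fixes \<rho> :: real and \<mu> :: complex
  assumes \<rho>_pos: "0 < \<rho>" and \<rho>_less_1: "\<rho> < 1" and \<rho>_root: "\<rho> ^ 3 = 1 - \<rho> - \<rho>\<^sup>2"
    and \<mu>_root: "\<mu>\<^sup>2 = - of_real (1 + \<rho>) * \<mu> - of_real (1 + \<rho> + \<rho>\<^sup>2)"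
    and \<mu>_nonreal: "Im \<mu> \<noteq> 0" and \<mu>_norm: "norm \<mu> > 1"

lemma characteristic_roots_exist: "\<exists>\<rho> \<mu>. characteristic_roots \<rho> \<mu>"
proof -
  have "\<exists>x\<ge>0. x \<le> 1 \<and> x ^ 3 + x\<^sup>2 + x = (1::real)"
    by (rule IVT') (auto intro!: continuous_intros)
  then obtain \<rho> :: real where \<rho>: "\<rho> \<ge> 0" "\<rho> \<le> 1" "\<rho> ^ 3 + \<rho>\<^sup>2 + \<rho> = 1" by blast
  then have \<rho>': "0 < \<rho>" "\<rho> < 1" by (cases "\<rho> = 0"; cases "\<rho> = 1"; simp)+
  define s where "s = sqrt (3 * \<rho>\<^sup>2 + 2 * \<rho> + 3)"
  have s2: "s\<^sup>2 = 3 * \<rho>\<^sup>2 + 2 * \<rho> + 3" using \<rho>' by (simp add: s_def)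
  have "s \<noteq> 0"
  proof
    assume "s = 0"
    then have "3 * \<rho>\<^sup>2 + 2 * \<rho> + 3 = 0" using s2 by simp
    then show False using \<rho>' by (smt (verit) zero_le_power2)
  qed
  define \<mu> where "\<mu> = Complex (- (1 + \<rho>) / 2) (s / 2)"
  have "\<mu>\<^sup>2 = - of_real (1 + \<rho>) * \<mu> - of_real (1 + \<rho> + \<rho>\<^sup>2)"
  proof (rule complex_eqI)
    have "((1 + \<rho>) / 2)\<^sup>2 - (s / 2)\<^sup>2 = (1 + \<rho>)\<^sup>2 / 2 - (1 + \<rho> + \<rho>\<^sup>2)"
      by (simp add: power_divide s2) (simp add: power2_eq_square field_simps)
    then show "Re (\<mu>\<^sup>2) = Re (- of_real (1 + \<rho>) * \<mu> - of_real (1 + \<rho> + \<rho>\<^sup>2))"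
      by (simp add: \<mu>_def power2_eq_square field_simps)
  qed (simp add: \<mu>_def power2_eq_square field_simps)
  moreover have "norm \<mu> > 1"
  proof -
    have "(norm \<mu>)\<^sup>2 = 1 + \<rho> + \<rho>\<^sup>2"
      by (simp add: \<mu>_def cmod_power2 power_divide s2) (simp add: power2_eq_square field_simps)
    moreover have "0 < \<rho> + \<rho>\<^sup>2" using \<rho>' by (intro add_pos_pos zero_less_power)
    ultimately have "1 < (norm \<mu>)\<^sup>2" by simp
    then show ?thesis by (metis norm_ge_zero one_power2 power_less_imp_less_base)
  qed
  moreover have "\<rho> ^ 3 = 1 - \<rho> - \<rho>\<^sup>2" using \<rho>(3) by simp
  ultimately have "characteristic_roots \<rho> \<mu>"
    using \<rho>' \<open>s \<noteq> 0\<close> by unfold_locales (simp_all add: \<mu>_def)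
  then show ?thesis by blast
qed

text \<open>
  The integers depend on the exponent but not on the root, which allows comparing \<open>\<mu>\<close> with \<open>\<rho>\<close>.
\<close>

lemma power_eq_integer_quadratic:
  "\<exists>a b c :: int. \<forall>x :: complex. x ^ 3 = 1 - x - x\<^sup>2 \<longrightarrow>
     x ^ n = of_int a + of_int b * x + of_int c * x\<^sup>2"
proof (induction n)
  case 0
  show ?case by (intro exI[of _ 1] exI[of _ 0]) simp
next
  case (Suc n)
  then obtain a b c :: int where abc: "\<And>x :: complex. x ^ 3 = 1 - x - x\<^sup>2 \<Longrightarrow>
     x ^ n = of_int a + of_int b * x + of_int c * x\<^sup>2" by blast
  have "x ^ Suc n = of_int c + of_int (a - c) * x + of_int (b - c) * x\<^sup>2"
    if x: "x ^ 3 = 1 - x - x\<^sup>2" for x :: complex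
  proof -
    have "x ^ Suc n = of_int a * x + of_int b * x\<^sup>2 + of_int c * x ^ 3"
      by (simp add: abc[OF x]) (simp add: algebra_simps power2_eq_square power3_eq_cube)
    then show ?thesis unfolding x by (simp add: algebra_simps)
  qed
  then show ?case by blast
qed

context characteristic_roots
begin

lemma \<mu>_cubic: "\<mu> ^ 3 = 1 - \<mu> - \<mu>\<^sup>2"
proof -
  define r where "r = complex_of_real \<rho>"
  have r: "r ^ 3 = 1 - r - r\<^sup>2"
    using arg_cong[OF \<rho>_root, of complex_of_real] by (simp add: r_def)
  have m: "\<mu>\<^sup>2 = - (1 + r) * \<mu> - (1 + r + r\<^sup>2)" using \<mu>_root by (simp add: r_def)
  have "\<mu> ^ 3 + \<mu>\<^sup>2 + \<mu> - 1 = (\<mu> - r) * (\<mu>\<^sup>2 + (1 + r) * \<mu> + (1 + r + r\<^sup>2)) + (r ^ 3 + r\<^sup>2 + r - 1)"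
    by (simp add: algebra_simps power2_eq_square power3_eq_cube)
  also have "\<dots> = 0" by (simp add: m r algebra_simps)
  finally show ?thesis by (simp add: algebra_simps)
qed

text \<open>
  A rational root of a monic integer polynomial is an integer, and there is none between 0 and 1.
\<close>

lemma \<rho>_irrational: "\<rho> \<notin> \<rat>"
proof
  assume "\<rho> \<in> \<rat>"
  moreover have "algebraic_int \<rho>"
  proof (rule algebraic_int.intros)
    show "lead_coeff [:-1, 1, 1, 1 :: real:] = 1" by simp
    show "\<forall>i. coeff [:-1, 1, 1, 1 :: real:] i \<in> \<int>"
      by (auto simp: coeff_pCons split: nat.splits)
    show "poly [:-1, 1, 1, 1:] \<rho> = 0"
      using \<rho>_root by (simp add: algebra_simps power2_eq_square power3_eq_cube)
  qed
  ultimately have "\<rho> \<in> \<int>" by (rule rational_algebraic_int_is_int[rotated])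
  then obtain k where "\<rho> = of_int k" by (auto elim: Ints_cases)
  then show False using \<rho>_pos \<rho>_less_1 by simp
qed

text \<open>
  The imaginary part of \<open>a + b \<mu> + c \<mu>\<^sup>2\<close> is \<open>(b - c (1 + \<rho>)) Im \<mu>\<close>. If it vanishes then \<open>b = c = 0\<close>
  because \<open>\<rho>\<close> is irrational, and \<open>\<rho> ^ m = a\<close> would be an integer.
\<close>

lemma \<mu>_power_nonreal:
  assumes "m \<ge> 1"
  shows "\<mu> ^ m \<notin> \<real>"
proof
  assume real: "\<mu> ^ m \<in> \<real>"
  obtain a b c :: int where abc: "\<And>x :: complex. x ^ 3 = 1 - x - x\<^sup>2 \<Longrightarrow>
     x ^ m = of_int a + of_int b * x + of_int c * x\<^sup>2"
    using power_eq_integer_quadratic[of m] by blast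
  have Im_sq: "Im (\<mu>\<^sup>2) = - (1 + \<rho>) * Im \<mu>" unfolding \<mu>_root by simp
  have "Im (of_int a + of_int b * \<mu> + of_int c * \<mu>\<^sup>2) = of_int b * Im \<mu> + of_int c * Im (\<mu>\<^sup>2)"
    by (simp del: Im_power2)
  then have "Im (\<mu> ^ m) = (of_int b - of_int c * (1 + \<rho>)) * Im \<mu>"
    unfolding abc[OF \<mu>_cubic] Im_sq by (simp add: algebra_simps)
  moreover have "Im (\<mu> ^ m) = 0" using real complex_is_Real_iff by blast
  ultimately have b: "of_int b = of_int c * (1 + \<rho>)" using \<mu>_nonreal by simp
  have "c = 0"
  proof (rule ccontr)
    assume "c \<noteq> 0"
    then have "\<rho> = of_int b / of_int c - 1" using b by (simp add: field_simps)
    then show False using \<rho>_irrational by simp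
  qed
  then have "b = 0" using b by simp
  have "(of_real \<rho> :: complex) ^ 3 = 1 - of_real \<rho> - (of_real \<rho>)\<^sup>2"
    using arg_cong[OF \<rho>_root, of complex_of_real] by simp
  then have "complex_of_real (\<rho> ^ m) = of_real (of_int a)"
    using abc \<open>b = 0\<close> \<open>c = 0\<close> by simp
  then have "\<rho> ^ m = of_int a" by (rule of_real_eq_iff[THEN iffD1])
  moreover have "0 < \<rho> ^ m" "\<rho> ^ m < 1"
    using \<rho>_pos \<rho>_less_1 assms by (simp_all add: power_Suc_less_one power_less_one_iff)
  ultimately show False by simp
qed

text \<open>
  The operator with characteristic polynomial \<open>t\<^sup>2 + (1 + \<rho>) t + (1 + \<rho> + \<rho>\<^sup>2)\<close> annihilates the
  contribution of \<open>\<mu>\<close> and multiplies \<open>\<rho> ^ n\<close> by \<open>3 \<rho>\<^sup>2 + 2 \<rho> + 1\<close>, which yields \<open>c\<close>. The number \<open>w\<close>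
  is then fitted to the first two values of the remaining sequence.
\<close>

lemma recurrence_solution:
  fixes t :: "nat \<Rightarrow> real"
  assumes rec: "\<And>n. t (n + 3) = t n - t (n + 1) - t (n + 2)"
  obtains w c where "\<And>n. t n = Re (w * \<mu> ^ n) + c * \<rho> ^ n"
proof -
  define D where "D = 3 * \<rho>\<^sup>2 + 2 * \<rho> + 1"
  have D: "D > 0" using \<rho>_pos by (auto simp: D_def intro: add_nonneg_pos)
  define c where "c = (t 2 + (1 + \<rho>) * t 1 + (1 + \<rho> + \<rho>\<^sup>2) * t 0) / D"
  define x where "x n = t n - c * \<rho> ^ n" for n
  define w where "w = Complex (x 0) ((x 0 * Re \<mu> - x 1) / Im \<mu>)"
  have x_rec: "x (n + 3) = x n - x (n + 1) - x (n + 2)" for n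
  proof -
    have "\<rho> ^ (n + 3) = \<rho> ^ n - \<rho> ^ (n + 1) - \<rho> ^ (n + 2)"
      unfolding power_add \<rho>_root by (simp add: algebra_simps)
    then have "c * \<rho> ^ (n + 3) = c * \<rho> ^ n - c * \<rho> ^ (n + 1) - c * \<rho> ^ (n + 2)"
      by (simp only: right_diff_distrib)
    then show ?thesis unfolding x_def using rec[of n] by linarith
  qed
  have w_rec: "Re (w * \<mu> ^ (n + 3)) = Re (w * \<mu> ^ n) - Re (w * \<mu> ^ (n + 1)) - Re (w * \<mu> ^ (n + 2))" for n
  proof -
    have "w * \<mu> ^ (n + 3) = w * \<mu> ^ n - w * \<mu> ^ (n + 1) - w * \<mu> ^ (n + 2)"
      unfolding power_add \<mu>_cubic by (simp add: algebra_simps)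
    then show ?thesis by (simp only: minus_complex.sel)
  qed
  have w0: "Re (w * \<mu> ^ 0) = x 0" by (simp add: w_def)
  have w1: "Re (w * \<mu> ^ 1) = x 1" using \<mu>_nonreal by (simp add: w_def)
  have w2: "Re (w * \<mu> ^ 2) = x 2"
  proof -
    have "w * \<mu>\<^sup>2 = - (of_real (1 + \<rho>) * (w * \<mu>)) - of_real (1 + \<rho> + \<rho>\<^sup>2) * w"
      unfolding \<mu>_root by (simp add: algebra_simps)
    moreover have "Re (of_real r * z) = r * Re z" for r z by simp
    ultimately have "Re (w * \<mu>\<^sup>2) = - ((1 + \<rho>) * Re (w * \<mu>)) - (1 + \<rho> + \<rho>\<^sup>2) * Re w"
      by (simp only: minus_complex.sel uminus_complex.sel)
    also have "\<dots> = - ((1 + \<rho>) * x 1) - (1 + \<rho> + \<rho>\<^sup>2) * x 0"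
      using w0 w1 by (simp only: power_0 power_one_right mult_1_right)
    also have "\<dots> = x 2"
    proof -
      have "c * D = t 2 + (1 + \<rho>) * t 1 + (1 + \<rho> + \<rho>\<^sup>2) * t 0" using D by (simp add: c_def)
      then show ?thesis by (simp add: x_def D_def algebra_simps power2_eq_square)
    qed
    finally show ?thesis .
  qed
  have "Re (w * \<mu> ^ n) = x n" for n
  proof (induction n rule: less_induct)
    case (less n)
    show ?case
    proof (cases "n < 3")
      case True
      then have "n = 0 \<or> n = 1 \<or> n = 2" by auto
      then show ?thesis using w0 w1 w2 by blast
    next
      case False
      then obtain m where m: "n = m + 3" by (metis add.commute le_Suc_ex not_less)
      show ?thesis
        using less[of m] less[of "m + 1"] less[of "m + 2"] unfolding m w_rec x_rec by simp
    qed
  qed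
  then show ?thesis by (intro that[of w c]) (simp add: x_def)
qed

section \<open>The growth of the degrees\<close>

text \<open>
  The maximum changes by at most the sum of the changes of its arguments, all of which are
  multiples of \<open>\<rho> ^ n\<close>. If \<open>w = 0\<close> the integer sequence is geometric with ratio \<open>\<rho>\<close>.
\<close>

lemma column_degree_asymptotics:
  obtains w where
    "(\<lambda>n. (real_of_int (column_degree a b c n) - support_function {0, w, w * \<mu>, w * (\<mu> + \<mu>\<^sup>2)} (\<mu> ^ n))
       / norm \<mu> ^ n) \<longlonglongrightarrow> 0"
    "w = 0 \<Longrightarrow> of_int b = of_int a * \<rho>"
proof -
  define t where "t n = real_of_int (cubic_seq a b c n)" for n
  obtain w k where t_eq: "\<And>n. t n = Re (w * \<mu> ^ n) + k * \<rho> ^ n"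
  proof (rule recurrence_solution[of t])
    show "t (n + 3) = t n - t (n + 1) - t (n + 2)" for n
      unfolding t_def cubic_seq_rec of_int_diff ..
  qed blast
  let ?W = "{0, w, w * \<mu>, w * (\<mu> + \<mu>\<^sup>2)}"
  have bound: "\<bar>real_of_int (column_degree a b c n) - support_function ?W (\<mu> ^ n)\<bar> \<le> 4 * \<bar>k\<bar> * \<rho> ^ n" for n
  proof -
    define x y where "x j = t (n + j)" and "y j = Re (w * \<mu> ^ (n + j))" for j
    have diff: "\<bar>x j - y j\<bar> \<le> \<bar>k\<bar> * \<rho> ^ n" for j
    proof -
      have "\<bar>x j - y j\<bar> = \<bar>k\<bar> * \<rho> ^ (n + j)" 
        unfolding x_def y_def t_eq add_diff_cancel_left' abs_mult using \<rho>_pos by simp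
      also have "\<dots> \<le> \<bar>k\<bar> * \<rho> ^ n"
        using \<rho>_pos \<rho>_less_1 by (intro mult_left_mono power_decreasing) auto
      finally show ?thesis .
    qed
    have "real_of_int (column_degree a b c n) = max 0 (max (x 0) (max (x 1) (x 1 + x 2)))"
      by (simp add: column_degree_def x_def t_def)
    moreover have "support_function ?W (\<mu> ^ n) = max 0 (max (y 0) (max (y 1) (y 1 + y 2)))"
    proof -
      have "w * (\<mu> + \<mu>\<^sup>2) * \<mu> ^ n = w * \<mu> ^ (n + 1) + w * \<mu> ^ (n + 2)"
        by (simp add: algebra_simps power2_eq_square)
      then have "Re (0 * \<mu> ^ n) = 0" "Re (w * \<mu> ^ n) = y 0" "Re (w * \<mu> * \<mu> ^ n) = y 1"
        "Re (w * (\<mu> + \<mu>\<^sup>2) * \<mu> ^ n) = y 1 + y 2"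
        by (simp_all only: y_def plus_complex.sel) (simp_all add: mult.assoc)
      then show ?thesis unfolding support_function_def image_insert image_empty by simp
    qed
    ultimately show ?thesis using diff[of 0] diff[of 1] diff[of 2] by linarith
  qed
  have "(\<lambda>n. (real_of_int (column_degree a b c n) - support_function ?W (\<mu> ^ n)) / norm \<mu> ^ n) \<longlonglongrightarrow> 0"
  proof (rule Lim_null_comparison)
    show "\<forall>\<^sub>F n in sequentially. norm ((real_of_int (column_degree a b c n) - support_function ?W (\<mu> ^ n)) / norm \<mu> ^ n)
        \<le> 4 * \<bar>k\<bar> * (\<rho> / norm \<mu>) ^ n"
      using bound \<mu>_norm by (intro always_eventually allI) (simp add: power_divide divide_right_mono)
    have "\<rho> < 1 * norm \<mu>" using \<rho>_less_1 \<mu>_norm by linarith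
    then have "\<rho> / norm \<mu> < 1" using \<mu>_norm by (simp add: divide_less_eq)
    then have "(\<lambda>n. (\<rho> / norm \<mu>) ^ n) \<longlonglongrightarrow> 0"
      using \<rho>_pos by (intro LIMSEQ_power_zero) simp
    then show "(\<lambda>n. 4 * \<bar>k\<bar> * (\<rho> / norm \<mu>) ^ n) \<longlonglongrightarrow> 0"
      by (rule tendsto_mult_right_zero)
  qed
  moreover have "of_int b = of_int a * \<rho>" if "w = 0"
    using t_eq[of 0] t_eq[of 1] that by (simp add: t_def)
  ultimately show ?thesis by (rule that)
qed

end

theorem proposition7p3:
  fixes A :: "int^3^3" and f :: "3 option \<Rightarrow> 3 option cpoly"
  assumes "A = vector [vector [-1, 1, 0],
                       vector [-1, 0, 1],
                       vector [ 1, 0, 0]]"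
    and "f = projectivization (affine_monomial_map A)"
  shows "map (\<lambda>N. map_degree (map_power f N)) [0..<21] =
           [1, 2, 3, 4, 6, 9, 12, 17, 25, 33, 45, 65, 85, 112, 159, 215, 262, 365, 524, 627, 833]
         \<and> \<not> satisfies_linear_recurrence (\<lambda>N. of_nat (map_degree (map_power f N)))"
proof
  let ?deg = "\<lambda>N. map_degree (map_power f N)"
  have deg: "int (?deg N) = column_degree 1 1 0 N + column_degree 0 (-1) 1 N +
      column_degree 0 0 (-1) N + column_degree (-1) 0 0 N" for N
    using degree_sequence[OF assms] .
  have "map int (map ?deg [0..<21]) =
      [1, 2, 3, 4, 6, 9, 12, 17, 25, 33, 45, 65, 85, 112, 159, 215, 262, 365, 524, 627, 833]"
    unfolding map_map comp_def deg by (rule degree_values)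
  also have "\<dots> =
      map int [1, 2, 3, 4, 6, 9, 12, 17, 25, 33, 45, 65, 85, 112, 159, 215, 262, 365, 524, 627, 833]"
    by simp
  finally show "map ?deg [0..<21] =
      [1, 2, 3, 4, 6, 9, 12, 17, 25, 33, 45, 65, 85, 112, 159, 215, 262, 365, 524, 627, 833]"
    by (rule map_injective) (simp add: inj_def)
next
  let ?deg = "\<lambda>N. map_degree (map_power f N)"
  have deg: "int (?deg N) = column_degree 1 1 0 N + column_degree 0 (-1) 1 N +
      column_degree 0 0 (-1) N + column_degree (-1) 0 0 N" for N
    using degree_sequence[OF assms] .
  obtain \<rho> \<mu> where "characteristic_roots \<rho> \<mu>" using characteristic_roots_exist by blast
  then interpret characteristic_roots \<rho> \<mu> .
  define I :: "(int \<times> int \<times> int) set" where "I = {(1, 1, 0), (0, -1, 1), (0, 0, -1), (-1, 0, 0)}"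
  define W where "W w = {0, w, w * \<mu>, w * (\<mu> + \<mu>\<^sup>2)}" for w
  have "\<exists>w. (\<lambda>n. (real_of_int (column_degree a b c n) - support_function (W w) (\<mu> ^ n)) / norm \<mu> ^ n) \<longlonglongrightarrow> 0
      \<and> (w = 0 \<longrightarrow> of_int b = of_int a * \<rho>)" for a b c
    unfolding W_def by (rule column_degree_asymptotics[of a b c]) blast
  then obtain w where w: "\<And>a b c. (\<lambda>n. (real_of_int (column_degree a b c n) - support_function (W (w a b c)) (\<mu> ^ n))
      / norm \<mu> ^ n) \<longlonglongrightarrow> 0" "\<And>a b c. w a b c = 0 \<Longrightarrow> of_int b = of_int a * \<rho>"
    by metis
  define V where "V = (\<lambda>(a, b, c). W (w a b c))"
  \<comment> \<open>The initial values 1, 1 are not in the ratio \<open>\<rho> < 1\<close>.\<close>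
  have "w 1 1 0 \<noteq> 0" using w(2)[of 1 1 0] \<rho>_less_1 by auto
  then have "\<not> is_singleton (V (1, 1, 0))"
    by (auto simp: V_def W_def is_singleton_def)
  moreover have "(\<lambda>n. (real (?deg n) - (\<Sum>i\<in>I. support_function (V i) (\<mu> ^ n))) / norm \<mu> ^ n) \<longlonglongrightarrow> 0"
  proof -
    have "(\<lambda>n. \<Sum>(a, b, c)\<in>I. (real_of_int (column_degree a b c n) - support_function (V (a, b, c)) (\<mu> ^ n)) / norm \<mu> ^ n)
        \<longlonglongrightarrow> 0"
      by (rule tendsto_null_sum) (auto simp: V_def w(1))
    moreover have "real (?deg n) = (\<Sum>(a, b, c)\<in>I. real_of_int (column_degree a b c n))" for n
      using arg_cong[OF deg[of n], of real_of_int] by (simp add: I_def)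
    ultimately show ?thesis
      by (simp add: sum_subtractf case_prod_beta flip: sum_divide_distrib)
  qed
  ultimately have "\<not> satisfies_linear_recurrence (\<lambda>n. of_real (real (?deg n)))"
    using \<mu>_power_nonreal
    by (intro not_linear_recurrence_if_polygons[where I = I and W = V and \<mu> = \<mu> and i = "(1, 1, 0)"])
       (auto simp: I_def V_def W_def)
  then show "\<not> satisfies_linear_recurrence (\<lambda>N. of_nat (?deg N))" by simp
qed

end
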